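(* Let $d = 2m$, where $m$ is an odd integer with $m \ge 3$, and let $K$ be any totally ramified (finite) extension of $\mathbb{Q}_2$. Then every additive form $$a_1x_1^{d} + a_2x_2^{d} + \cdots + a_s x_s^{d}, \qquad a_i \in K,$$ in $s \ge \frac{d^2}{4} + 3d + 1$ variables has a nontrivial zero in $K^s$. Equivalently, $\Gamma^*(d,K) \le \frac{d^2}{4} + 3d + 1$.
   Context: For a $p$-adic field $K$ and a positive integer $d$, $\Gamma^*(d,K)$ denotes the minimum number such that every additive form $a_1x_1^d+\cdots+a_sx_s^d$ with coefficients in $K$ in at least that many variables has a nontrivial zero over $K$. *)

theory Defs
  imports
    "HOL-Computational_Algebra.Computational_Algebra"
    "HOL-Number_Theory.Number_Theory"
    "HOL-Library.Extended_Nat"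
begin

section \<open>The ring of 2-adic integers\<close>

text \<open>
  The inverse limit of the rings \<open>\<int>/2\<^sup>n\<int>\<close>. The \<open>n\<close>-th component is the representative
  in \<open>{0..<2^n}\<close>; the range constraint follows from the compatibility condition.
\<close>

typedef two_adic_int = "{f :: nat \<Rightarrow> int. \<forall>n. f (Suc n) mod 2 ^ n = f n}"
  morphisms residue_of Abs_two_adic_int
  by (rule exI[of _ "\<lambda>_. 0"]) auto

setup_lifting type_definition_two_adic_int

lemma mod_pow2_Suc: "(x :: int) mod 2 ^ Suc n mod 2 ^ n = x mod 2 ^ n"
  by (simp add: mod_mod_cancel)

lemma compatible_mod_self:
  fixes f :: "nat \<Rightarrow> int"
  assumes "\<forall>n. f (Suc n) mod 2 ^ n = f n"
  shows "f n mod 2 ^ n = f n"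
  by (metis assms mod_mod_trivial)

instantiation two_adic_int :: comm_ring_1
begin

lift_definition zero_two_adic_int :: two_adic_int is "\<lambda>_. 0" by simp

lift_definition one_two_adic_int :: two_adic_int is "\<lambda>n. 1 mod 2 ^ n"
  by (simp only: mod_pow2_Suc)

lift_definition plus_two_adic_int :: "two_adic_int \<Rightarrow> two_adic_int \<Rightarrow> two_adic_int"
  is "\<lambda>f g n. (f n + g n) mod 2 ^ n"
  by (simp only: mod_pow2_Suc) (metis mod_add_eq)

lift_definition uminus_two_adic_int :: "two_adic_int \<Rightarrow> two_adic_int"
  is "\<lambda>f n. (- f n) mod 2 ^ n"
  by (simp only: mod_pow2_Suc) (metis mod_minus_eq)

lift_definition minus_two_adic_int :: "two_adic_int \<Rightarrow> two_adic_int \<Rightarrow> two_adic_int"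
  is "\<lambda>f g n. (f n - g n) mod 2 ^ n"
  by (simp only: mod_pow2_Suc) (metis mod_diff_eq)

lift_definition times_two_adic_int :: "two_adic_int \<Rightarrow> two_adic_int \<Rightarrow> two_adic_int"
  is "\<lambda>f g n. (f n * g n) mod 2 ^ n"
  by (simp only: mod_pow2_Suc) (metis mod_mult_eq)

instance
proof
  fix a b c :: two_adic_int
  show "a * b * c = a * (b * c)"
    by transfer (simp only: mod_mult_left_eq mod_mult_right_eq mult.assoc)
  show "a * b = b * a"
    by transfer (simp only: mult.commute)
  show "1 * a = a"
    by transfer (simp only: mod_mult_left_eq mult_1, simp add: compatible_mod_self)
  show "a + b + c = a + (b + c)"
    by transfer (simp only: mod_add_left_eq mod_add_right_eq add.assoc)
  show "a + b = b + a"
    by transfer (simp only: add.commute)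
  show "0 + a = a"
    by transfer (simp add: compatible_mod_self)
  show "- a + a = 0"
    by transfer (simp add: mod_add_left_eq)
  show "a - b = a + - b"
    by transfer (simp add: mod_add_right_eq)
  show "(a + b) * c = a * c + b * c"
    by transfer (simp only: mod_mult_left_eq mod_add_left_eq mod_add_right_eq distrib_right)
  show "(0 :: two_adic_int) \<noteq> 1"
    by transfer (auto simp: fun_eq_iff intro!: exI[of _ 1])
qed

end

lemma residue_of_mod_self [simp]: "residue_of x n mod 2 ^ n = residue_of x n"
proof -
  have "residue_of x (Suc n) mod 2 ^ n = residue_of x n"
    using residue_of[of x] by simp
  thus ?thesis by (metis mod_mod_trivial)
qed

lemma residue_of_range: "residue_of x n \<ge> 0" "residue_of x n < 2 ^ n"
  by (metis residue_of_mod_self pos_mod_sign pos_mod_bound zero_less_numeral zero_less_power)+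

lemma residue_of_mod: "m \<le> n \<Longrightarrow> residue_of x n mod 2 ^ m = residue_of x m"
proof (induction rule: dec_induct)
  case (step k)
  have "residue_of x (Suc k) mod 2 ^ m = residue_of x (Suc k) mod 2 ^ k mod 2 ^ m"
    using step.hyps by (simp add: mod_mod_cancel le_imp_power_dvd)
  also have "residue_of x (Suc k) mod 2 ^ k = residue_of x k"
    using residue_of[of x] by simp
  finally show ?case using step.IH by simp
qed simp

lemma two_adic_int_eq_iff: "x = y \<longleftrightarrow> (\<forall>n. residue_of x n = residue_of y n)"
  by (metis residue_of_inject ext)

lemma residue_of_dvd_iff: "m \<le> n \<Longrightarrow> 2 ^ m dvd residue_of x n \<longleftrightarrow> residue_of x m = 0"
  using residue_of_mod[of m n x] by (simp add: dvd_eq_mod_eq_0)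

instance two_adic_int :: idom
proof
  fix x y :: two_adic_int
  assume "x \<noteq> 0" "y \<noteq> 0"
  then obtain a b where a: "residue_of x a \<noteq> 0" and b: "residue_of y b \<noteq> 0"
    by (auto simp: two_adic_int_eq_iff zero_two_adic_int.rep_eq)
  define X where "X = residue_of x (a + b)"
  define Y where "Y = residue_of y (a + b)"
  have X: "\<not> 2 ^ a dvd X" and Y: "\<not> 2 ^ b dvd Y"
    using a b by (simp_all add: X_def Y_def residue_of_dvd_iff)
  have p: "prime (2 :: int)" by simp
  have nz: "X \<noteq> 0" "Y \<noteq> 0" using X Y by auto
  have "multiplicity 2 X < a" "multiplicity 2 Y < b"
    using X Y multiplicity_dvd'[of _ 2] by (meson not_less)+
  hence "multiplicity 2 (X * Y) < a + b"
    using nz p by (simp add: prime_elem_multiplicity_mult_distrib)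
  hence "\<not> 2 ^ (a + b) dvd X * Y"
    using nz p by (metis multiplicity_geI mult_eq_0_iff not_less not_is_unit_0
        prime_elem_not_unit prime_imp_prime_elem)
  hence "residue_of (x * y) (a + b) \<noteq> 0"
    by (simp add: times_two_adic_int.rep_eq X_def Y_def dvd_eq_mod_eq_0)
  thus "x * y \<noteq> 0" by (auto simp: zero_two_adic_int.rep_eq)
qed

lemma residue_of_of_nat: "residue_of (of_nat k) n = int k mod 2 ^ n"
  by (induction k)
     (simp_all add: zero_two_adic_int.rep_eq plus_two_adic_int.rep_eq one_two_adic_int.rep_eq mod_simps)

lemma residue_of_pow2: "residue_of (2 ^ k) n = 2 ^ k mod 2 ^ n"
  using residue_of_of_nat[of "2 ^ k" n] by simp

lemma pow2_dvd_two_adic_int_iff: "2 ^ k dvd (x :: two_adic_int) \<longleftrightarrow> residue_of x k = 0"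
proof
  assume "2 ^ k dvd x"
  then obtain y where "x = 2 ^ k * y" by (rule dvdE)
  thus "residue_of x k = 0"
    by (simp add: times_two_adic_int.rep_eq residue_of_pow2)
next
  assume *: "residue_of x k = 0"
  have dvd: "2 ^ k dvd residue_of x (n + k)" for n
    using * by (simp add: residue_of_dvd_iff)
  define y where "y = Abs_two_adic_int (\<lambda>n. residue_of x (n + k) div 2 ^ k)"
  have compat: "(residue_of x (Suc n + k) div 2 ^ k) mod 2 ^ n = residue_of x (n + k) div 2 ^ k" for n
  proof -
    have "2 ^ k * ((residue_of x (Suc n + k) div 2 ^ k) mod 2 ^ n) =
          (2 ^ k * (residue_of x (Suc n + k) div 2 ^ k)) mod (2 ^ k * 2 ^ n)"
      by (rule mult_mod_right)
    also have "2 ^ k * (residue_of x (Suc n + k) div 2 ^ k) = residue_of x (Suc n + k)"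
      using dvd[of "Suc n"] by (rule dvd_mult_div_cancel)
    also have "\<dots> mod (2 ^ k * 2 ^ n) = residue_of x (n + k)"
      using residue_of_mod[of "n + k" "Suc n + k" x] by (simp only: power_add mult.commute)
    also have "\<dots> = 2 ^ k * (residue_of x (n + k) div 2 ^ k)"
      using dvd[of n] by (rule dvd_mult_div_cancel[symmetric])
    finally show ?thesis by simp
  qed
  have y: "residue_of y n = residue_of x (n + k) div 2 ^ k" for n
    unfolding y_def using compat by (subst Abs_two_adic_int_inverse) auto
  have "x = 2 ^ k * y"
  proof (subst two_adic_int_eq_iff, intro allI)
    fix n
    have "residue_of (2 ^ k * y) n = (2 ^ k * (residue_of x (n + k) div 2 ^ k)) mod 2 ^ n"
      by (simp only: times_two_adic_int.rep_eq residue_of_pow2 y mod_mult_left_eq)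
    also have "\<dots> = residue_of x n"
      using dvd[of n] residue_of_mod[of n "n + k" x] by (simp only: dvd_mult_div_cancel)
    finally show "residue_of x n = residue_of (2 ^ k * y) n" by simp
  qed
  thus "2 ^ k dvd x" by simp
qed

lemma two_adic_int_unit_iff: "(x :: two_adic_int) dvd 1 \<longleftrightarrow> \<not> 2 dvd x"
proof
  assume "x dvd 1"
  show "\<not> 2 dvd x"
  proof
    assume "2 dvd x"
    hence "2 ^ 1 dvd (1 :: two_adic_int)" using \<open>x dvd 1\<close> dvd_trans[of 2 x 1] by simp
    thus False by (subst (asm) pow2_dvd_two_adic_int_iff) (simp add: one_two_adic_int.rep_eq)
  qed
next
  assume "\<not> 2 dvd x"
  hence *: "residue_of x 1 \<noteq> 0" using pow2_dvd_two_adic_int_iff[of 1 x] by simp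
  have cop: "coprime (residue_of x n) (2 ^ n)" for n
  proof (cases "n = 0")
    case False
    hence "\<not> 2 ^ 1 dvd residue_of x n" using * by (subst residue_of_dvd_iff) auto
    thus ?thesis by simp
  qed simp
  define g where "g = (\<lambda>n. modular_inverse (2 ^ n) (residue_of x n))"
  have g1: "[residue_of x n * g n = 1] (mod 2 ^ n)" for n
    unfolding g_def by (rule cong_modular_inverse1) (rule cop)
  have "g (Suc n) mod 2 ^ n = g n" for n
  proof -
    have "[residue_of x (Suc n) * g (Suc n) = 1] (mod 2 ^ n)"
      using g1[of "Suc n"] by (rule cong_dvd_modulus) simp
    hence "[residue_of x (Suc n) mod 2 ^ n * (g (Suc n) mod 2 ^ n) = 1] (mod 2 ^ n)"
      by (simp only: cong_def mod_mult_eq)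
    hence "[residue_of x n * (g (Suc n) mod 2 ^ n) = 1] (mod 2 ^ n)"
      by (simp add: residue_of_mod)
    thus ?thesis
      unfolding g_def[THEN fun_cong, of n] by (intro modular_inverse_int_eqI[symmetric]) auto
  qed
  hence g: "residue_of (Abs_two_adic_int g) = g"
    by (intro Abs_two_adic_int_inverse) auto
  have "x * Abs_two_adic_int g = 1"
    using g1 by (simp add: two_adic_int_eq_iff times_two_adic_int.rep_eq one_two_adic_int.rep_eq g cong_def)
  thus "x dvd 1" by (metis dvd_triv_left)
qed

lemma two_adic_int_decompose:
  assumes "(x :: two_adic_int) \<noteq> 0"
  obtains k u where "u dvd 1" "x = 2 ^ k * u"
proof -
  obtain n where n: "residue_of x n \<noteq> 0"
    using assms by (auto simp: two_adic_int_eq_iff zero_two_adic_int.rep_eq)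
  define k where "k = (GREATEST k. 2 ^ k dvd x)"
  have bd: "j \<le> n" if "2 ^ j dvd x" for j
  proof (rule ccontr)
    assume "\<not> j \<le> n"
    hence "2 ^ n dvd x" using that dvd_trans[OF le_imp_power_dvd[of n j 2] that] by simp
    thus False using n by (simp add: pow2_dvd_two_adic_int_iff)
  qed
  have "2 ^ k dvd x" unfolding k_def by (rule GreatestI_nat[of _ 0 n]) (auto intro: bd)
  then obtain u where u: "x = 2 ^ k * u" by (rule dvdE)
  have "\<not> 2 dvd u"
  proof
    assume "2 dvd u"
    then obtain v where "u = 2 * v" by (rule dvdE)
    hence "x = 2 ^ Suc k * v" using u by simp
    hence "2 ^ Suc k dvd x" by (metis dvd_triv_left)
    hence "Suc k \<le> k" unfolding k_def by (rule Greatest_le_nat) (rule bd)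
    thus False by simp
  qed
  thus ?thesis using that[of u k] u by (simp add: two_adic_int_unit_iff)
qed


section \<open>The field of 2-adic numbers and its valuation\<close>

type_synonym two_adic = "two_adic_int fract"

text \<open>
  Every nonzero 2-adic number is \<open>2\<^sup>k u\<close> for a unique integer \<open>k\<close> and a unit \<open>u\<close> of the
  2-adic integers; the value at \<open>0\<close> is irrelevant.
\<close>

definition two_adic_val :: "two_adic \<Rightarrow> int" where
  "two_adic_val x = (THE k. \<exists>u. u dvd 1 \<and> x = 2 powi k * Fract u 1)"

lemma two_Fract: "(2 :: two_adic) = Fract 2 1"
proof -
  have "(2 :: two_adic) = Fract 1 1 + Fract 1 1" by (simp add: One_fract_def[symmetric])
  thus ?thesis by (simp add: add_fract)
qed

lemma pow2_Fract: "(2 :: two_adic) ^ k = Fract (2 ^ k) 1"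
  by (induction k) (auto simp: One_fract_def two_Fract)

lemma two_adic_two_neq_0 [simp]: "(2 :: two_adic) \<noteq> 0"
proof -
  have "residue_of (2 ^ 1) 2 \<noteq> residue_of 0 2"
    by (simp only: residue_of_pow2 zero_two_adic_int.rep_eq) simp
  hence "(2 :: two_adic_int) \<noteq> 0" by auto
  thus ?thesis by (simp add: two_Fract Zero_fract_def eq_fract)
qed

lemma two_adic_decompose:
  assumes "(x :: two_adic) \<noteq> 0"
  obtains k u where "u dvd 1" "x = 2 powi k * Fract u 1"
proof -
  obtain a b where ab: "x = Fract a b" "b \<noteq> 0" by (cases x) auto
  with assms have "a \<noteq> 0" by (auto simp: Zero_fract_def eq_fract)
  obtain i u where u: "u dvd 1" "a = 2 ^ i * u" using \<open>a \<noteq> 0\<close> by (rule two_adic_int_decompose)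
  obtain j v where v: "v dvd 1" "b = 2 ^ j * v" using \<open>b \<noteq> 0\<close> by (rule two_adic_int_decompose)
  from v(1) obtain w where w: "v * w = 1" by (metis dvdE)
  have nz: "v \<noteq> 0" "(2 :: two_adic_int) ^ j \<noteq> 0" using ab v by auto
  have "a * 2 ^ j = 2 ^ i * (u * w) * b"
  proof -
    have "2 ^ i * (u * w) * b = 2 ^ i * u * 2 ^ j * (v * w)"
      using v(2) by (simp add: ac_simps)
    thus ?thesis by (simp only: u(2) w mult_1_right)
  qed
  hence "x = Fract (2 ^ i * (u * w)) (2 ^ j)"
    using ab nz by (simp add: eq_fract)
  also have "\<dots> = Fract (2 ^ i) 1 / Fract (2 ^ j) 1 * Fract (u * w) 1"
    by simp
  also have "\<dots> = 2 powi (int i - int j) * Fract (u * w) 1"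
    by (simp add: power_int_diff pow2_Fract)
  finally have "x = 2 powi (int i - int j) * Fract (u * w) 1" .
  moreover have "u * w dvd 1" using mult_dvd_mono[of u 1 w 1] u(1) w by (metis dvd_triv_right mult_1)
  ultimately show ?thesis using that by blast
qed

lemma two_adic_val_unique_aux:
  assumes "u dvd 1" "v dvd 1" "(2 :: two_adic) powi i * Fract u 1 = 2 powi j * Fract v 1"
  shows "i \<le> j"
proof (rule ccontr)
  assume "\<not> i \<le> j"
  hence k: "i = j + int (Suc k)" if "k = nat (i - j - 1)" for k
    using that by simp
  define k where "k = nat (i - j - 1)"
  note k = k[OF k_def]
  have "2 powi j * (Fract (2 ^ Suc k) 1 * Fract u 1) = 2 powi j * Fract v 1"
  proof -
    have "(2 :: two_adic) powi i = 2 powi j * 2 powi int (Suc k)"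
      unfolding k by (rule power_int_add) simp
    also have "(2 :: two_adic) powi int (Suc k) = Fract (2 ^ Suc k) 1"
      by (simp only: power_int_of_nat pow2_Fract)
    finally show ?thesis using assms(3) by (simp only: mult.assoc)
  qed
  hence "Fract (2 ^ Suc k) 1 * Fract u 1 = Fract v 1" by simp
  hence "2 * (2 ^ k * u) = v" by (simp add: eq_fract ac_simps)
  hence "2 dvd v" by (metis dvd_triv_left)
  thus False using assms(2) by (simp add: two_adic_int_unit_iff)
qed

lemma two_adic_val_eq:
  assumes "u dvd 1" "x = 2 powi k * Fract u 1"
  shows "two_adic_val x = k"
  unfolding two_adic_val_def
proof (rule the_equality)
  fix j assume "\<exists>v. v dvd 1 \<and> x = 2 powi j * Fract v 1"
  thus "j = k" using assms two_adic_val_unique_aux by (metis antisym)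
qed (use assms in blast)


section \<open>Totally ramified extensions\<close>

text \<open>
  A field extension is given by an embedding \<open>\<iota>\<close> of the base field; \<open>\<lambda>c x. \<iota> c * x\<close> is the
  resulting scalar multiplication.
\<close>

definition field_embedding :: "('a::field \<Rightarrow> 'b::field) \<Rightarrow> bool" where
  "field_embedding \<iota> \<longleftrightarrow>
     \<iota> 1 = 1 \<and> (\<forall>x y. \<iota> (x + y) = \<iota> x + \<iota> y) \<and> (\<forall>x y. \<iota> (x * y) = \<iota> x * \<iota> y)"

definition finite_extension :: "('a::field \<Rightarrow> 'b::field) \<Rightarrow> bool" where
  "finite_extension \<iota> \<longleftrightarrow> field_embedding \<iota> \<and>
     (\<exists>B. finite B \<and> module.span (\<lambda>c x. \<iota> c * x) B = UNIV)"

definition extension_degree :: "('a::field \<Rightarrow> 'b::field) \<Rightarrow> nat" where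
  "extension_degree \<iota> = vector_space.dim (\<lambda>c x. \<iota> c * x) UNIV"

text \<open>
  Normalized discrete valuations, with value group all of \<open>\<int>\<close>. The value at \<open>0\<close>
  (mathematically \<open>\<infinity>\<close>) is irrelevant.
\<close>

definition normalized_valuation :: "('a::field \<Rightarrow> int) \<Rightarrow> bool" where
  "normalized_valuation w \<longleftrightarrow>
     (\<forall>x y. x \<noteq> 0 \<longrightarrow> y \<noteq> 0 \<longrightarrow> w (x * y) = w x + w y) \<and>
     (\<forall>x y. x \<noteq> 0 \<longrightarrow> y \<noteq> 0 \<longrightarrow> x + y \<noteq> 0 \<longrightarrow> w (x + y) \<ge> min (w x) (w y)) \<and>
     w ` (- {0}) = UNIV"

text \<open>
  The valuation of \<open>\<rat>\<^sub>2\<close> extends uniquely to a finite extension \<open>K\<close>. Normalizing the extension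
  to a valuation \<open>w\<close> with value group \<open>\<int>\<close>, its restriction to \<open>\<rat>\<^sub>2\<close> is \<open>e\<close> times the 2-adic
  valuation, where \<open>e\<close> is the ramification index.
\<close>

definition has_ramification_index :: "(two_adic \<Rightarrow> 'k::field) \<Rightarrow> nat \<Rightarrow> bool" where
  "has_ramification_index \<iota> e \<longleftrightarrow>
     (\<exists>w. normalized_valuation w \<and> (\<forall>x. x \<noteq> 0 \<longrightarrow> w (\<iota> x) = int e * two_adic_val x))"

definition totally_ramified_extension :: "(two_adic \<Rightarrow> 'k::field) \<Rightarrow> bool" where
  "totally_ramified_extension \<iota> \<longleftrightarrow>
     finite_extension \<iota> \<and> has_ramification_index \<iota> (extension_degree \<iota>)"


lemma two_adic_val_mult:
  assumes "x \<noteq> 0" "y \<noteq> 0"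
  shows "two_adic_val (x * y) = two_adic_val x + two_adic_val y"
proof -
  obtain i u where u: "u dvd 1" "x = 2 powi i * Fract u 1" using assms(1) by (rule two_adic_decompose)
  obtain j v where v: "v dvd 1" "y = 2 powi j * Fract v 1" using assms(2) by (rule two_adic_decompose)
  have "x * y = 2 powi (i + j) * Fract (u * v) 1"
    by (simp add: u v power_int_add ac_simps flip: mult_fract[of u 1 v 1, simplified])
  moreover have "u * v dvd 1" using mult_dvd_mono[OF u(1) v(1)] by simp
  ultimately show ?thesis using two_adic_val_eq[OF u] two_adic_val_eq[OF v] two_adic_val_eq by metis
qed

lemma two_adic_val_add_aux:
  assumes "x \<noteq> 0" "y \<noteq> 0" "x + y \<noteq> 0" "two_adic_val x \<le> two_adic_val y"
  shows "two_adic_val (x + y) \<ge> two_adic_val x"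
proof -
  obtain i u where u: "u dvd 1" "x = 2 powi i * Fract u 1" using assms(1) by (rule two_adic_decompose)
  obtain j v where v: "v dvd 1" "y = 2 powi j * Fract v 1" using assms(2) by (rule two_adic_decompose)
  have ij: "i \<le> j" using assms(4) two_adic_val_eq[OF u] two_adic_val_eq[OF v] by simp
  define k where "k = nat (j - i)"
  have k: "j = i + int k" using ij by (simp add: k_def)
  define z where "z = u + 2 ^ k * v"
  have "y = 2 powi i * (2 ^ k * Fract v 1)"
    unfolding v k by (subst power_int_add) (auto simp: mult.assoc)
  also have "2 ^ k * Fract v 1 = Fract (2 ^ k * v) 1" by (simp add: pow2_Fract)
  finally have eq: "x + y = 2 powi i * Fract z 1"
    by (simp add: u z_def flip: distrib_left)
  have "z \<noteq> 0"
  proof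
    assume "z = 0"
    thus False using assms(3) by (simp add: eq flip: Zero_fract_def)
  qed
  then obtain l t where t: "t dvd 1" "z = 2 ^ l * t" by (rule two_adic_int_decompose)
  have "x + y = 2 powi (i + int l) * Fract t 1"
  proof -
    have "Fract z 1 = 2 ^ l * Fract t 1" by (simp add: pow2_Fract t)
    thus ?thesis unfolding eq by (subst power_int_add) (auto simp: mult.assoc)
  qed
  hence "two_adic_val (x + y) = i + int l" by (rule two_adic_val_eq[OF t(1)])
  thus ?thesis using two_adic_val_eq[OF u] by simp
qed

lemma normalized_valuation_two_adic: "normalized_valuation two_adic_val"
proof -
  have "min (two_adic_val x) (two_adic_val y) \<le> two_adic_val (x + y)"
    if "x \<noteq> 0" "y \<noteq> 0" "x + y \<noteq> 0" for x y
    using two_adic_val_add_aux[of x y] two_adic_val_add_aux[of y x] that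
    by (cases "two_adic_val x \<le> two_adic_val y") (auto simp: add.commute)
  moreover have "k \<in> two_adic_val ` (- {0})" for k
  proof (rule image_eqI)
    show "k = two_adic_val (2 powi k)"
      by (rule two_adic_val_eq[symmetric, of 1]) (auto simp flip: One_fract_def)
  qed auto
  ultimately show ?thesis
    unfolding normalized_valuation_def by (auto simp: two_adic_val_mult)
qed

lemma totally_ramified_extension_id: "totally_ramified_extension (\<lambda>x. x)"
proof -
  interpret vector_space "\<lambda>c x. c * x :: two_adic"
    by unfold_locales (auto simp: algebra_simps)
  have sp: "span {1 :: two_adic} = UNIV"
  proof -
    have "x \<in> span {1}" for x using span_scale[of 1 "{1}" x] span_base[of 1 "{1}"] by simp
    thus ?thesis by blast
  qed
  have "independent {1 :: two_adic}" by simp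
  hence "extension_degree (\<lambda>x::two_adic. x) = 1"
    unfolding extension_degree_def using dim_eq_card[of "{1}" UNIV] sp by (simp add: span_UNIV)
  moreover have "finite_extension (\<lambda>x::two_adic. x)"
    unfolding finite_extension_def field_embedding_def using sp by (auto intro!: exI[of _ "{1}"])
  ultimately show ?thesis
    unfolding totally_ramified_extension_def has_ramification_index_def
    using normalized_valuation_two_adic by auto
qed


section \<open>Additive forms\<close>

text \<open>Coefficients and variables are indexed by \<open>0, \<dots>, s - 1\<close>.\<close>

definition additive_form :: "nat \<Rightarrow> nat \<Rightarrow> (nat \<Rightarrow> 'a::field) \<Rightarrow> (nat \<Rightarrow> 'a) \<Rightarrow> 'a" where
  "additive_form d s a x = (\<Sum>i<s. a i * x i ^ d)"

definition has_nontrivial_zero :: "nat \<Rightarrow> nat \<Rightarrow> (nat \<Rightarrow> 'a::field) \<Rightarrow> bool" where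
  "has_nontrivial_zero d s a \<longleftrightarrow> (\<exists>x. (\<exists>i<s. x i \<noteq> 0) \<and> additive_form d s a x = 0)"

text \<open>The value is \<open>\<infinity>\<close> if no number of variables suffices.\<close>

definition Gamma_star :: "nat \<Rightarrow> 'a::field itself \<Rightarrow> enat" where
  "Gamma_star d K =
     Inf {enat N | N. \<forall>s\<ge>N. \<forall>a :: nat \<Rightarrow> 'a. has_nontrivial_zero d s a}"

end

theory Submission
  imports Defs
begin

text \<open>
  The residue field is \<open>\<F>\<^sub>2\<close> and \<open>m\<close> is odd, so every unit is an \<open>m\<close>-th power and the problem is to solve
  \<open>\<Sum> a\<^sub>i y\<^sub>i\<^sup>2 = 0\<close> with \<open>y\<^sub>i = 0\<close> or \<open>m\<close> dividing \<open>w(y\<^sub>i)\<close>; only the levels \<open>w(a\<^sub>i)\<close> modulo \<open>2 m\<close> matter.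
  Let \<open>e = w(2)\<close>. Two variables of level \<open>j\<close> form a binary form which is isotropic, or represents
  all elements of level \<open>j + 2 e\<close>, or has an odd quadratic defect \<open>k < 2 e\<close>. In the last case it
  represents half of the elements of level \<open>j + k\<close>: for \<open>w(x) = j + k\<close> and \<open>w(\<rho>) = 2 e - k\<close> one of
  \<open>x\<close> and \<open>x (1 + \<rho>)\<close> is represented. Two disjoint pairs arriving in this way at the same level either
  yield a zero, or have the same \<open>j\<close> and \<open>k\<close> and together represent all elements of level \<open>j + 2 e\<close>.
  Hence, if there is no zero, the levels reached by pairs from different classes \<open>j\<close> are
  distinct, and a class containing a set which represents all of level \<open>j + 2 e\<close> forces the class \<open>j + 2 e\<close>
  to be empty apart from that set. Counting over the \<open>m\<close> classes of each parity
  leaves at most \<open>9 m\<close> variables, and \<open>9 m < m\<^sup>2 + 6 m + 1\<close> for \<open>m \<ge> 3\<close>.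
\<close>

section \<open>Quadratic defects over dyadic fields\<close>

locale valued_field =
  fixes w :: "'k::field \<Rightarrow> int"
  assumes normalized: "normalized_valuation w"
begin

text \<open>Valuation at least \<open>n\<close>, with 0 counted as having infinite value, since
  \<open>w 0\<close> is arbitrary.\<close>

definition vge :: "'k \<Rightarrow> int \<Rightarrow> bool" where
  "vge x n \<longleftrightarrow> x = 0 \<or> n \<le> w x"

lemma w_mult: "x \<noteq> 0 \<Longrightarrow> y \<noteq> 0 \<Longrightarrow> w (x * y) = w x + w y"
  using normalized by (auto simp: normalized_valuation_def)

lemma w_one [simp]: "w 1 = 0"
  using w_mult[of 1 1] by simp

lemma w_minus [simp]: "w (- x) = w x"
proof (cases "x = 0")
  case False
  have "w (- 1) = 0" using w_mult[of "-1" "-1"] by simp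
  thus ?thesis using w_mult[of "-1" x] False by simp
qed simp

lemma w_power: "x \<noteq> 0 \<Longrightarrow> w (x ^ n) = int n * w x"
  by (induction n) (auto simp: w_mult algebra_simps)

lemma w_inverse: "x \<noteq> 0 \<Longrightarrow> w (inverse x) = - w x"
  using w_mult[of x "inverse x"] by simp

lemma w_divide: "x \<noteq> 0 \<Longrightarrow> y \<noteq> 0 \<Longrightarrow> w (x / y) = w x - w y"
  by (simp add: divide_inverse w_mult w_inverse)

lemma w_surj: obtains x where "x \<noteq> 0" "w x = n"
proof -
  have "n \<in> w ` (- {0})" using normalized by (simp add: normalized_valuation_def)
  thus ?thesis using that by auto
qed

lemma vge_0 [simp]: "vge 0 n"
  by (simp add: vge_def)

lemma vge_nz: "x \<noteq> 0 \<Longrightarrow> vge x n \<longleftrightarrow> n \<le> w x"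
  by (simp add: vge_def)

lemma vge_mono: "vge x n \<Longrightarrow> k \<le> n \<Longrightarrow> vge x k"
  by (auto simp: vge_def)

lemma vge_minus [simp]: "vge (- x) n \<longleftrightarrow> vge x n"
  by (simp add: vge_def)

lemma vge_add:
  assumes "vge x n" "vge y n"
  shows "vge (x + y) n"
proof (cases "x = 0 \<or> y = 0 \<or> x + y = 0")
  case False
  hence "w (x + y) \<ge> min (w x) (w y)"
    using normalized by (auto simp: normalized_valuation_def)
  thus ?thesis using assms False by (auto simp: vge_def)
qed (use assms in auto)

lemma vge_diff: "vge x n \<Longrightarrow> vge y n \<Longrightarrow> vge (x - y) n"
  using vge_add[of x n "- y"] by simp

lemma vge_mult: "vge x n \<Longrightarrow> vge y k \<Longrightarrow> vge (x * y) (n + k)"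
  by (cases "x = 0 \<or> y = 0") (auto simp: vge_def w_mult)

lemma vge_mult0: "vge x n \<Longrightarrow> vge y 0 \<Longrightarrow> vge (x * y) n"
  using vge_mult[of x n y 0] by simp

lemma vge_sum: "(\<And>i. i \<in> A \<Longrightarrow> vge (f i) n) \<Longrightarrow> vge (sum f A) n"
  by (induction A rule: infinite_finite_induct) (auto intro: vge_add)

lemma vge_zero_if_all: "(\<And>n. vge x n) \<Longrightarrow> x = 0"
  by (metis vge_def less_add_one not_less)

lemma w_add_eq:
  assumes "x \<noteq> 0" "vge y (w x + 1)"
  shows "x + y \<noteq> 0" "w (x + y) = w x"
proof -
  show nz: "x + y \<noteq> 0"
  proof
    assume "x + y = 0"
    hence "y = - x" by (simp add: eq_neg_iff_add_eq_0 add.commute)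
    thus False using assms by (simp add: vge_def)
  qed
  have "vge x (w x)" using assms by (simp add: vge_def)
  hence "vge (x + y) (w x)" using assms(2) vge_mono vge_add by (meson less_add_one order_less_imp_le)
  hence "w x \<le> w (x + y)" using nz by (simp add: vge_def)
  moreover have "w (x + y) \<le> w x"
  proof (rule ccontr)
    assume "\<not> ?thesis"
    hence "vge (x + y) (w x + 1)" by (simp add: vge_def)
    hence "vge (x + y - y) (w x + 1)" using assms(2) by (rule vge_diff)
    thus False using assms(1) by (simp add: vge_def)
  qed
  ultimately show "w (x + y) = w x" by simp
qed

text \<open>When the values are pairwise distinct, the summand of least value strictly dominates and
  nothing cancels.\<close>

lemma w_sum_inj:
  assumes "finite A" "A \<noteq> {}" "\<And>i. i \<in> A \<Longrightarrow> f i \<noteq> 0" "inj_on (\<lambda>i. w (f i)) A"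
  shows "sum f A \<noteq> 0 \<and> w (sum f A) = Min ((\<lambda>i. w (f i)) ` A)"
  using assms
proof (induction A rule: finite_ne_induct)
  case (insert i A)
  have IH: "sum f A \<noteq> 0" "w (sum f A) = Min ((\<lambda>i. w (f i)) ` A)"
    using insert by (auto simp: inj_on_def)
  have fi: "f i \<noteq> 0" using insert by simp
  have "w (sum f A) \<in> (\<lambda>i. w (f i)) ` A"
    unfolding IH(2) using insert by (intro Min_in) auto
  hence ne: "w (f i) \<noteq> w (sum f A)"
    using insert.hyps insert.prems(2) by (auto simp: inj_on_def)
  have "Min ((\<lambda>i. w (f i)) ` insert i A) = min (w (f i)) (w (sum f A))"
    using insert.hyps by (simp add: IH(2))
  moreover have "f i + sum f A \<noteq> 0 \<and> w (f i + sum f A) = min (w (f i)) (w (sum f A))"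
  proof (cases "w (f i) < w (sum f A)")
    case True
    thus ?thesis using w_add_eq[of "f i" "sum f A"] fi by (simp add: vge_def)
  next
    case False
    thus ?thesis using w_add_eq[of "sum f A" "f i"] IH(1) ne by (simp add: vge_def add.commute)
  qed
  ultimately show ?case using insert.hyps by simp
qed auto

end

section \<open>Complete dyadic fields with residue field of two elements\<close>

locale dyadic_field = valued_field w for w :: "'k::field \<Rightarrow> int" +
  fixes e :: nat
  assumes e_pos: "e > 0"
    and two_nz: "(2 :: 'k) \<noteq> 0"
    and w_two: "w 2 = int e"
    and residue: "\<And>x. x \<noteq> 0 \<Longrightarrow> w x = 0 \<Longrightarrow> vge (x - 1) 1"
    and complete: "\<And>x :: nat \<Rightarrow> 'k. (\<And>n. vge (x (Suc n) - x n) (int n)) \<Longrightarrow>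
                     \<exists>l. \<forall>n. vge (l - x n) (int n)"
begin

text \<open>There is only one nonzero residue class, so elements of equal value have a quotient
  congruent to 1 and their leading digits cancel. The digit corrections below rest on this.\<close>

lemma same_level_diff:
  assumes "x \<noteq> 0" "y \<noteq> 0" "w x = w y"
  shows "vge (x - y) (w x + 1)"
proof -
  have "vge (x / y - 1) 1" using assms by (intro residue) (auto simp: w_divide)
  hence "vge (y * (x / y - 1)) (w y + 1)" using assms by (intro vge_mult) (auto simp: vge_def)
  thus ?thesis using assms by (simp add: algebra_simps)
qed

lemma same_level_add:
  assumes "x \<noteq> 0" "y \<noteq> 0" "w x = w y"
  shows "vge (x + y) (w x + 1)"
  using same_level_diff[of x "- y"] assms by simp

text \<open>Banach's argument on the residue disc of \<open>c\<close>: the iterates starting at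
  \<open>c\<close> gain one level per step. It takes the place of Hensel's lemma.\<close>

lemma contraction_fixpoint:
  fixes F :: "'k \<Rightarrow> 'k"
  assumes maps: "\<And>x. vge (x - c) 1 \<Longrightarrow> vge (F x - c) 1"
    and contr: "\<And>x y n. vge (x - c) 1 \<Longrightarrow> vge (y - c) 1 \<Longrightarrow> vge (x - y) n \<Longrightarrow> vge (F x - F y) (n + 1)"
  obtains l where "vge (l - c) 1" "F l = l"
proof -
  define x where "x n = (F ^^ n) c" for n
  have x: "x 0 = c" "x (Suc n) = F (x n)" for n by (auto simp: x_def)
  have near: "vge (x n - c) 1" for n by (induction n) (auto simp: x maps)
  have step: "vge (x (Suc n) - x n) (int n + 1)" for n
  proof (induction n)
    case 0
    show ?case using near[of 1] by (simp add: x)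
  next
    case (Suc n)
    thus ?case using contr[OF near near Suc] by (simp add: x algebra_simps)
  qed
  hence "vge (x (Suc n) - x n) (int n)" for n by (rule vge_mono) simp
  then obtain l where l: "\<And>n. vge (l - x n) (int n)" using complete by blast
  have lc: "vge (l - c) 1" using vge_add[OF _ near[of 1], of "l - x 1"] l[of 1] by simp
  have "vge (F l - l) n" for n
  proof -
    define k where "k = nat n"
    have "vge (F l - x (Suc k)) (int k + 1)"
      unfolding x(2) by (intro contr lc near l)
    moreover have "vge (x (Suc k) - l) (int k + 1)"
      using l[of "Suc k"] vge_minus[of "l - x (Suc k)"] by (simp add: add.commute del: vge_minus)
    ultimately have "vge (F l - l) (int k + 1)"
      using vge_add by fastforce
    thus ?thesis by (rule vge_mono) (simp add: k_def)
  qed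
  hence "F l - l = 0" by (rule vge_zero_if_all)
  thus ?thesis using that lc by simp
qed

text \<open>On the maximal ideal \<open>g - t ^ 2\<close> contracts, because
  \<open>x ^ 2 - y ^ 2\<close> has the factor \<open>x + y\<close> of positive value.\<close>

lemma artin_schreier:
  assumes "vge g 1"
  obtains t where "vge t 1" "t ^ 2 + t = g"
proof (rule contraction_fixpoint[of 0 "\<lambda>t. g - t ^ 2"])
  fix x assume "vge (x - 0) 1"
  thus "vge (g - x ^ 2 - 0) 1"
    using assms vge_mult[of x 1 x 1] by (auto intro!: vge_diff intro: vge_mono simp: power2_eq_square)
next
  fix x y n assume "vge (x - 0) 1" "vge (y - 0) 1" "vge (x - y) n"
  hence "vge ((x - y) * (- (x + y))) (n + 1)" by (intro vge_mult) (auto intro: vge_add simp del: minus_add_distrib)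
  also have "(x - y) * (- (x + y)) = g - x ^ 2 - (g - y ^ 2)"
    by (simp add: algebra_simps power2_eq_square)
  finally show "vge (g - x ^ 2 - (g - y ^ 2)) (n + 1)" .
next
  fix l assume "vge (l - 0) 1" "g - l ^ 2 = l"
  thus ?thesis using that[of l] by (simp add: algebra_simps)
qed

definition unit :: "'k \<Rightarrow> bool" where
  "unit x \<longleftrightarrow> x \<noteq> 0 \<and> w x = 0"

lemma unit_near: "vge (x - 1) 1 \<longleftrightarrow> unit x"
  using w_add_eq[of 1 "x - 1"] residue by (auto simp: unit_def)

lemma unit_mult [intro]: "unit x \<Longrightarrow> unit y \<Longrightarrow> unit (x * y)"
  by (simp add: unit_def w_mult)

lemma unit_1 [simp]: "unit 1"
  by (simp add: unit_def)

lemma unit_power [intro]: "unit x \<Longrightarrow> unit (x ^ n)"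
  by (simp add: unit_def w_power)

lemma unit_add: "unit x \<Longrightarrow> vge y 1 \<Longrightarrow> unit (x + y)"
  using w_add_eq[of x y] by (auto simp: unit_def)

text \<open>The map \<open>y - (y ^ m - u)\<close> contracts around 1: its derivative is congruent
  to \<open>1 - m\<close>, which has positive value for odd \<open>m\<close>.\<close>

lemma unit_root:
  assumes "odd m" "unit u"
  obtains y where "unit y" "y ^ m = u"
proof (rule contraction_fixpoint[of 1 "\<lambda>y. y - (y ^ m - u)"])
  fix x assume "vge (x - 1) 1"
  moreover from this have "vge (x ^ m - u) 1"
    using same_level_diff[of "x ^ m" u] unit_power[of x m] assms(2)
    by (auto simp: unit_near unit_def)
  ultimately have "vge (x - 1 - (x ^ m - u)) 1" by (rule vge_diff)
  thus "vge (x - (x ^ m - u) - 1) 1" by (simp add: algebra_simps)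
next
  fix x y n assume xy: "vge (x - 1) 1" "vge (y - 1) 1" "vge (x - y) n"
  \<comment> \<open>The cofactor of \<open>x - y\<close> in \<open>x ^ m - y ^ m\<close>; each of
    its \<open>m\<close> terms is congruent to 1.\<close>
  define S where "S = (\<Sum>i<m. x ^ i * y ^ (m - Suc i))"
  have "vge (S - of_nat m) 1"
  proof -
    have "S - of_nat m = (\<Sum>i<m. x ^ i * y ^ (m - Suc i) - 1)"
      by (simp add: S_def sum_subtractf)
    also have "vge \<dots> 1"
      using xy by (intro vge_sum) (auto simp: unit_near)
    finally show ?thesis .
  qed
  moreover have "vge (of_nat m - 1 :: 'k) 1"
  proof -
    obtain r where r: "m = 2 * r + 1" using assms(1) by (auto elim: oddE)
    have "vge (of_nat r :: 'k) 0"
      by (induction r) (auto intro!: vge_add simp: vge_nz)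
    moreover have "vge (2 :: 'k) 1" using e_pos by (simp add: vge_def w_two)
    ultimately show ?thesis using vge_mult0 by (simp add: r)
  qed
  ultimately have "vge (S - of_nat m + (of_nat m - 1)) 1" by (rule vge_add)
  hence "vge (1 - S) 1" using vge_minus[of "S - 1"] by (simp del: vge_minus)
  hence "vge ((x - y) * (1 - S)) (n + 1)" using xy by (intro vge_mult)
  moreover have "(x - y) * (1 - S) = x - y - (x ^ m - y ^ m)"
    using diff_power_eq_sum[of x "m - 1" y] assms(1) odd_pos[of m]
    by (simp add: S_def right_diff_distrib)
  moreover have "\<dots> = x - (x ^ m - u) - (y - (y ^ m - u))" by simp
  ultimately show "vge (x - (x ^ m - u) - (y - (y ^ m - u))) (n + 1)" by argo
next
  fix l assume "vge (l - 1) 1" "l - (l ^ m - u) = l"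
  thus ?thesis using that[of l] by (simp add: unit_near)
qed

text \<open>For a nonsquare \<open>c\<close> these are norms from the quadratic extension generated
  by a root of \<open>c\<close>. Both coordinates are units, so that later they serve as nonzero
  variables whose valuation is divisible by \<open>m\<close>.\<close>

definition norm_value :: "'k \<Rightarrow> 'k \<Rightarrow> bool" where
  "norm_value c x \<longleftrightarrow> (\<exists>a b. unit a \<and> unit b \<and> a ^ 2 - c * b ^ 2 = x)"

text \<open>This is the change \<open>(b + t) ^ 2 - b ^ 2\<close>. For \<open>w t\<close> below
  \<open>w 2\<close> the term \<open>t ^ 2\<close> dominates, so the change has an even
  level.\<close>

lemma w_square_increment:
  assumes "unit b" "t \<noteq> 0" "w t < int e"
  shows "2 * b * t + t ^ 2 \<noteq> 0" "w (2 * b * t + t ^ 2) = 2 * w t"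
proof -
  have "vge (2 * b * t) (w (t ^ 2) + 1)"
    using assms two_nz by (simp add: unit_def w_mult w_power w_two vge_def)
  thus "2 * b * t + t ^ 2 \<noteq> 0" "w (2 * b * t + t ^ 2) = 2 * w t"
    using w_add_eq[of "t ^ 2" "2 * b * t"] assms by (auto simp: add.commute w_power)
qed

text \<open>A form of the local square theorem: an error beyond level \<open>2 * e\<close> is
  absorbed by replacing \<open>b\<close> with \<open>b * (1 + 2 * t)\<close>, whose square gains the
  factor \<open>1 + 4 * (t ^ 2 + t)\<close>.\<close>

lemma norm_value_lift:
  assumes "unit a" "unit b" "unit c" "vge (a ^ 2 - c * b ^ 2 - x) (2 * int e + 1)"
  shows "norm_value c x"
proof -
  define g where "g = (a ^ 2 - c * b ^ 2 - x) / (2 ^ 2 * (c * b ^ 2))"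
  have "(2 :: 'k) ^ 2 \<noteq> 0" using two_nz by (rule power_not_zero)
  hence nz: "2 ^ 2 * (c * b ^ 2) \<noteq> 0" using assms by (auto simp: unit_def)
  have "w ((2 :: 'k) ^ 2) = 2 * int e" using w_power[OF two_nz, of 2] w_two by simp
  hence "w (2 ^ 2 * (c * b ^ 2)) = 2 * int e"
    using assms nz w_mult[of "2 ^ 2" "c * b ^ 2"] by (auto simp: unit_def w_mult w_power)
  hence "vge g 1"
    using assms(4) nz by (cases "a ^ 2 - c * b ^ 2 - x = 0") (auto simp: g_def vge_def w_divide)
  then obtain t where t: "vge t 1" "t ^ 2 + t = g" by (rule artin_schreier)
  have "vge (2 * t) (int e + 1)" using t(1) by (intro vge_mult) (auto simp: vge_def w_two)
  hence "unit (b * (1 + 2 * t))"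
    using assms by (intro unit_mult unit_add) (auto intro: vge_mono)
  moreover have "a ^ 2 - c * (b * (1 + 2 * t)) ^ 2 = x"
  proof -
    have "a ^ 2 - c * b ^ 2 - x = g * (2 ^ 2 * (c * b ^ 2))" using nz by (simp add: g_def)
    thus ?thesis unfolding t(2)[symmetric] by (simp add: algebra_simps power2_eq_square)
  qed
  ultimately show ?thesis using assms(1) by (auto simp: norm_value_def)
qed

text \<open>The level of \<open>1 - c * z ^ 2\<close> is raised step by step. An error at an even
  level \<open>2 * i\<close> is cancelled by moving \<open>z\<close> by an element of value
  \<open>i\<close>; at an odd level, which no square attains, the process stops.\<close>

lemma quadratic_defect:
  assumes "unit c" "1 \<le> n" "n \<le> 2 * e"
  shows "(\<exists>z. unit z \<and> vge (1 - c * z ^ 2) (int n)) \<or>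
         (\<exists>z k. unit z \<and> odd k \<and> k < n \<and> 1 - c * z ^ 2 \<noteq> 0 \<and> w (1 - c * z ^ 2) = int k)"
  using assms(2,3)
proof (induction n rule: nat_induct_at_least)
  case base
  have "vge (c * 1 ^ 2 - 1) 1" using assms(1) unit_near by simp
  hence "vge (1 - c * 1 ^ 2) 1" using vge_minus[of "c * 1 ^ 2 - 1"] by (simp del: vge_minus)
  thus ?case using unit_1 by (metis of_nat_1)
next
  case (Suc n)
  from Suc consider
      (a) z where "unit z" "vge (1 - c * z ^ 2) (int n)"
    | (b) z k where "unit z" "odd k" "k < n" "1 - c * z ^ 2 \<noteq> 0" "w (1 - c * z ^ 2) = int k"
    by auto
  thus ?case
  proof cases
    case b
    thus ?thesis using less_Suc_eq by blast
  next
    case a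
    let ?E = "1 - c * z ^ 2"
    consider "vge ?E (int (Suc n))" | "?E \<noteq> 0" "w ?E = int n" "odd n" | "?E \<noteq> 0" "w ?E = int n" "even n"
      using a(2) unfolding vge_def by fastforce
    thus ?thesis
    proof cases
      case 1
      thus ?thesis using a by blast
    next
      case 2
      thus ?thesis using a by blast
    next
      case 3
      then obtain i where i: "n = 2 * i" by (auto elim: evenE)
      obtain t where t: "t \<noteq> 0" "w t = int i" by (rule w_surj)
      have te: "w t < int e" using Suc.prems i t by simp
      have inc: "2 * z * t + t ^ 2 \<noteq> 0" "w (2 * z * t + t ^ 2) = int n"
        using w_square_increment[OF a(1) t(1) te] t i by auto
      have "vge (?E - c * (2 * z * t + t ^ 2)) (w ?E + 1)"
        using 3 inc assms(1) by (intro same_level_diff) (auto simp: unit_def w_mult)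
      moreover have "?E - c * (2 * z * t + t ^ 2) = 1 - c * (z + t) ^ 2"
        by (simp add: algebra_simps power2_eq_square)
      moreover have "unit (z + t)"
        using a(1) t i Suc.hyps by (intro unit_add) (auto simp: vge_def)
      ultimately show ?thesis using 3 by (metis add.commute of_nat_Suc)
    qed
  qed
qed

text \<open>
  The digits of the target are corrected one at a time. At an even distance above the leading
  digit one rescales \<open>a\<close> and \<open>b\<close> simultaneously by \<open>1 + t\<close>; at an odd distance one moves \<open>b\<close> alone.
  The second correction is available only strictly below level \<open>2 e\<close>, which is why the digit of
  the target at that level (at distance \<open>2 e - k\<close>) remains prescribed.
\<close>

lemma norm_value_approx:
  assumes c: "unit c" and z: "unit z" "odd k" "1 - c * z ^ 2 \<noteq> 0" "w (1 - c * z ^ 2) = int k"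
    and x: "x \<noteq> 0" "w x = int k" and n: "Suc k \<le> n" "n \<le> 2 * e"
  shows "\<exists>a b. unit a \<and> unit b \<and> vge (a ^ 2 - c * b ^ 2 - x) (int n)"
  using n
proof (induction n rule: nat_induct_at_least)
  case base
  have "vge (1 ^ 2 - c * z ^ 2 - x) (int (Suc k))"
    using same_level_diff[of "1 - c * z ^ 2" x] z x by (simp add: add.commute)
  thus ?case using z unit_1 by blast
next
  case (Suc n)
  then obtain a b where ab: "unit a" "unit b" "vge (a ^ 2 - c * b ^ 2 - x) (int n)"
    by auto
  let ?y = "a ^ 2 - c * b ^ 2"
  let ?D = "?y - x"
  have kn: "k < n" "n < 2 * e" using Suc by auto
  have wy: "?y \<noteq> 0" "w ?y = int k"
    using w_add_eq[of x ?D] x ab(3) kn vge_mono[of ?D "int n" "int k + 1"] by auto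
  consider "vge ?D (int (Suc n))" | "?D \<noteq> 0" "w ?D = int n" "odd n" | "?D \<noteq> 0" "w ?D = int n" "even n"
    using ab(3) unfolding vge_def by fastforce
  thus ?case
  proof cases
    case 1
    thus ?thesis using ab by blast
  next
    case 3
    then obtain i where i: "n = 2 * i" by (auto elim: evenE)
    obtain t where t: "t \<noteq> 0" "w t = int i" by (rule w_surj)
    have te: "w t < int e" using kn i t by simp
    have inc: "2 * b * t + t ^ 2 \<noteq> 0" "w (2 * b * t + t ^ 2) = int n"
      using w_square_increment[OF ab(2) t(1) te] t i by auto
    have "vge (?D - c * (2 * b * t + t ^ 2)) (w ?D + 1)"
      using 3 inc c by (intro same_level_diff) (auto simp: unit_def w_mult)
    moreover have "?D - c * (2 * b * t + t ^ 2) = a ^ 2 - c * (b + t) ^ 2 - x"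
      by (simp add: algebra_simps power2_eq_square)
    moreover have "unit (b + t)"
      using ab(2) t i kn by (intro unit_add) (auto simp: vge_def)
    ultimately show ?thesis using 3 ab(1) by (metis add.commute of_nat_Suc)
  next
    case 2
    define i where "i = (n - k) div 2"
    have i: "n = k + 2 * i" "i > 0" using 2 z(2) kn by (auto simp: i_def elim!: oddE) 
    obtain t where t: "t \<noteq> 0" "w t = int i" by (rule w_surj)
    have te: "w t < int e" using kn i t by simp
    have inc: "2 * 1 * t + t ^ 2 \<noteq> 0" "w (2 * 1 * t + t ^ 2) = 2 * int i"
      using w_square_increment[OF unit_1 t(1) te] t i by auto
    have "vge (?D + ?y * (2 * 1 * t + t ^ 2)) (w ?D + 1)"
      using 2 inc wy i by (intro same_level_add) (auto simp: w_mult)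
    moreover have "?D + ?y * (2 * 1 * t + t ^ 2) = (a * (1 + t)) ^ 2 - c * (b * (1 + t)) ^ 2 - x"
      by (simp add: algebra_simps power2_eq_square)
    moreover have "unit (a * (1 + t))" "unit (b * (1 + t))"
      using ab(1,2) t i by (auto intro!: unit_mult unit_add simp: vge_def)
    ultimately show ?thesis using 2 by (metis add.commute of_nat_Suc)
  qed
qed

text \<open>
  The third case is an elementary form of the fact that the unit norms from
  \<open>K(\<surd>c)\<close> have index 2 in the units, with conductor exponent \<open>2 e + 1 - k\<close>.
\<close>

lemma norm_value_cases:
  assumes c: "unit c"
  obtains "norm_value c 0"
  | "\<And>y. y \<noteq> 0 \<Longrightarrow> w y = 2 * int e \<Longrightarrow> norm_value c y"
  | k where "odd k" "k < 2 * e"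
      "\<And>x \<rho>. x \<noteq> 0 \<Longrightarrow> \<rho> \<noteq> 0 \<Longrightarrow> w x = int k \<Longrightarrow> w \<rho> = 2 * int e - int k \<Longrightarrow>
         norm_value c x \<or> norm_value c (x * (1 + \<rho>))"
proof -
  from quadratic_defect[OF c, of "2 * e"] e_pos consider
      (a) z where "unit z" "vge (1 - c * z ^ 2) (2 * int e)"
    | (b) z k where "unit z" "odd k" "k < 2 * e" "1 - c * z ^ 2 \<noteq> 0" "w (1 - c * z ^ 2) = int k"
    by auto
  thus ?thesis
  proof cases
    case a
    show ?thesis
    proof (cases "vge (1 - c * z ^ 2) (2 * int e + 1)")
      case True
      thus ?thesis using norm_value_lift[of 1 z c 0] a c that(1) by simp
    next
      case False
      \<comment> \<open>At exactly this level every \<open>y\<close> agrees with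
        \<open>1 - c * z ^ 2\<close> to one further digit, which is all that
        \<open>norm_value_lift\<close> needs.\<close>
      hence 1: "1 - c * z ^ 2 \<noteq> 0" "w (1 - c * z ^ 2) = 2 * int e"
        using a by (auto simp: vge_def)
      show ?thesis
      proof (rule that(2))
        fix y :: 'k assume "y \<noteq> 0" "w y = 2 * int e"
        thus "norm_value c y"
          using same_level_diff[OF 1(1), of y] 1 norm_value_lift[of 1 z c y] a c by simp
      qed
    qed
  next
    case b
    show ?thesis
    proof (rule that(3)[of k])
      fix x \<rho> :: 'k
      assume x: "x \<noteq> 0" "\<rho> \<noteq> 0" "w x = int k" "w \<rho> = 2 * int e - int k"
      obtain p q where pq: "unit p" "unit q" "vge (p ^ 2 - c * q ^ 2 - x) (int (2 * e))"
        using norm_value_approx[OF c b(1,2,4,5) x(1,3), of "2 * e"] b(3) by auto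
      let ?D = "p ^ 2 - c * q ^ 2 - x"
      show "norm_value c x \<or> norm_value c (x * (1 + \<rho>))"
      proof (cases "vge ?D (2 * int e + 1)")
        case True
        thus ?thesis using norm_value_lift pq c by blast
      next
        case False
        \<comment> \<open>The digit at level \<open>2 * e\<close> is wrong;
          \<open>x * \<rho>\<close> has just this level, so passing to
          \<open>x * (1 + \<rho>)\<close> flips it.\<close>
        hence "?D \<noteq> 0" "w ?D = 2 * int e" using pq by (auto simp: vge_def)
        hence "vge (?D - x * \<rho>) (2 * int e + 1)"
          using same_level_diff[of ?D "x * \<rho>"] x by (simp add: w_mult)
        also have "?D - x * \<rho> = p ^ 2 - c * q ^ 2 - x * (1 + \<rho>)" by (simp add: algebra_simps)
        finally show ?thesis using norm_value_lift pq c by blast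
      qed
    qed (use b in auto)
  qed
qed

end

section \<open>Additive forms of degree twice an odd number\<close>

text \<open>
  Since units are \<open>m\<close>-th powers, the squares \<open>y\<^sup>2\<close> with \<open>m\<close> dividing \<open>w y\<close> are the \<open>2 m\<close>-th powers.
  A form without nontrivial zero is therefore an instance of this locale.
\<close>

locale anisotropic_form = dyadic_field w e for w :: "'k::field \<Rightarrow> int" and e +
  fixes m :: nat and a :: "nat \<Rightarrow> 'k" and I :: "nat set"
  assumes m_pos: "m > 0" and finite_I: "finite I" and coeff_nz: "\<And>i. i \<in> I \<Longrightarrow> a i \<noteq> 0"
    and anisotropic: "\<And>S y. S \<subseteq> I \<Longrightarrow> S \<noteq> {} \<Longrightarrow> (\<And>i. i \<in> S \<Longrightarrow> y i \<noteq> 0 \<and> int m dvd w (y i)) \<Longrightarrow>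
      (\<Sum>i\<in>S. a i * y i ^ 2) \<noteq> 0"
begin

text \<open>All variables in \<open>S\<close> are nonzero, so representations by disjoint sets
  combine and a nonempty subset of \<open>I\<close> never represents 0.\<close>

definition represents :: "nat set \<Rightarrow> 'k \<Rightarrow> bool" where
  "represents S x \<longleftrightarrow> (\<exists>y. (\<forall>i\<in>S. y i \<noteq> 0 \<and> int m dvd w (y i)) \<and> (\<Sum>i\<in>S. a i * y i ^ 2) = x)"

lemma represents_nz: "represents S x \<Longrightarrow> S \<subseteq> I \<Longrightarrow> S \<noteq> {} \<Longrightarrow> x \<noteq> 0"
  unfolding represents_def using anisotropic[of S] by blast

lemma represents_singleton: "represents {i} (a i)"
  unfolding represents_def by (rule exI[of _ "\<lambda>_. 1"]) simp

lemma represents_scale: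
  assumes "represents S x" "z \<noteq> 0" "int m dvd w z"
  shows "represents S (x * z ^ 2)"
proof -
  obtain y where "\<forall>i\<in>S. y i \<noteq> 0 \<and> int m dvd w (y i)" "(\<Sum>i\<in>S. a i * y i ^ 2) = x"
    using assms(1) by (auto simp: represents_def)
  thus ?thesis unfolding represents_def using assms(2,3)
    by (intro exI[of _ "\<lambda>i. y i * z"]) (auto simp: w_mult sum_distrib_right power_mult_distrib mult.assoc)
qed

lemma represents_union:
  assumes "represents S x" "represents T y" "finite S" "finite T" "S \<inter> T = {}"
  shows "represents (S \<union> T) (x + y)"
proof -
  obtain p where p: "\<forall>i\<in>S. p i \<noteq> 0 \<and> int m dvd w (p i)" "(\<Sum>i\<in>S. a i * p i ^ 2) = x"
    using assms(1) by (auto simp: represents_def)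
  obtain q where q: "\<forall>i\<in>T. q i \<noteq> 0 \<and> int m dvd w (q i)" "(\<Sum>i\<in>T. a i * q i ^ 2) = y"
    using assms(2) by (auto simp: represents_def)
  let ?r = "\<lambda>i. if i \<in> S then p i else q i"
  have "(\<Sum>i\<in>T. a i * ?r i ^ 2) = (\<Sum>i\<in>T. a i * q i ^ 2)"
    using assms(5) by (intro sum.cong) auto
  hence "(\<Sum>i\<in>S \<union> T. a i * ?r i ^ 2) = x + y"
    using assms p q by (subst sum.union_disjoint) auto
  thus ?thesis unfolding represents_def using p(1) q(1) by (intro exI[of _ ?r]) auto
qed

lemma represents_no_cancel:
  assumes "represents S x" "represents T (- x)" "S \<subseteq> I" "T \<subseteq> I" "S \<noteq> {}" "S \<inter> T = {}"
  shows False
  using represents_union[OF assms(1,2)] represents_nz[of "S \<union> T"] assms finite_I finite_subset[of _ I]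
  by auto

abbreviation period :: int where "period \<equiv> 2 * int m"

text \<open>Scaling by \<open>z ^ 2\<close> with \<open>m\<close> dividing \<open>w z\<close> is
  reversible, so a target may be moved to the exact level \<open>n\<close>.\<close>

lemma represents_shift:
  assumes "x \<noteq> 0" "period dvd w x - n"
  obtains z where "z \<noteq> 0" "w (x * z ^ 2) = n" "\<And>T v. represents T (v * z ^ 2) \<Longrightarrow> represents T v"
proof -
  obtain q where q: "w x - n = period * q" using assms(2) by (rule dvdE)
  obtain z where z: "z \<noteq> 0" "w z = - (int m * q)" by (rule w_surj)
  have "represents T v" if "represents T (v * z ^ 2)" for T v
  proof -
    have "represents T (v * z ^ 2 * (inverse z) ^ 2)"
      using z by (intro represents_scale[OF that]) (auto simp: w_inverse)
    moreover have "v * z ^ 2 * (inverse z) ^ 2 = v"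
      using z(1) by (simp add: power_inverse)
    ultimately show ?thesis by (simp only:)
  qed
  moreover have "w (x * z ^ 2) = n" using assms(1) z q by (simp add: w_mult w_power)
  ultimately show ?thesis using that z(1) by blast
qed

definition represents_level :: "nat set \<Rightarrow> int \<Rightarrow> bool" where
  "represents_level S n \<longleftrightarrow> (\<forall>y. y \<noteq> 0 \<longrightarrow> period dvd w y - n \<longrightarrow> represents S y)"

text \<open>Here \<open>r\<close> is the distance from level \<open>n\<close> to the one digit that
  is not under control; a pair of defect \<open>k\<close> has \<open>r = 2 * e - k\<close>.\<close>

definition represents_half :: "nat set \<Rightarrow> int \<Rightarrow> int \<Rightarrow> bool" where
  "represents_half S n r \<longleftrightarrow>
     (\<forall>x \<rho>. x \<noteq> 0 \<longrightarrow> \<rho> \<noteq> 0 \<longrightarrow> period dvd w x - n \<longrightarrow> w \<rho> = r \<longrightarrow>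
        represents S x \<or> represents S (x * (1 + \<rho>)))"

text \<open>Factoring out \<open>a i\<close> leaves \<open>p ^ 2 - c * r ^ 2\<close> with a unit
  \<open>c\<close>, to which \<open>norm_value_cases\<close> applies; its first case would give a
  zero.\<close>

lemma represents_pair:
  assumes ij: "i \<in> I" "j \<in> I" "i \<noteq> j" "period dvd w (a i) - w (a j)"
  obtains "represents_level {i, j} (w (a i) + 2 * int e)"
  | k where "odd k" "k < 2 * e" "represents_half {i, j} (w (a i) + int k) (2 * int e - int k)"
proof -
  obtain q where q: "w (a i) - w (a j) = period * q" using ij(4) by (rule dvdE)
  \<comment> \<open>Half the level difference, so that \<open>a j * t ^ 2\<close> has the level of
    \<open>a i\<close>. As \<open>m\<close> divides \<open>w t\<close>, the factor \<open>t\<close>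
    can be absorbed into the second variable.\<close>
  obtain t where t: "t \<noteq> 0" "w t = int m * q" by (rule w_surj)
  have nz: "a i \<noteq> 0" "a j \<noteq> 0" using ij coeff_nz by auto
  define c where "c = - (a j * t ^ 2) / a i"
  have "unit c"
    using nz t q by (simp add: c_def unit_def w_divide w_mult w_power)
  have rep: "represents {i, j} (a i * y)" if "norm_value c y" for y
  proof -
    obtain p r where pr: "unit p" "unit r" "p ^ 2 - c * r ^ 2 = y"
      using \<open>norm_value c y\<close> by (auto simp: norm_value_def)
    define f where "f = (\<lambda>l. if l = i then p else t * r)"
    have "(\<Sum>l\<in>{i, j}. a l * f l ^ 2) = a i * y"
      using ij(3) nz by (simp add: f_def pr(3)[symmetric] c_def field_simps)
    moreover have "f l \<noteq> 0 \<and> int m dvd w (f l)" for l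
      using pr(1,2) t by (auto simp: f_def unit_def w_mult)
    ultimately show ?thesis unfolding represents_def by blast
  qed
  show ?thesis
    using \<open>unit c\<close>
  proof (cases rule: norm_value_cases)
    case 1
    thus ?thesis using rep[of 0] represents_nz[of "{i, j}" 0] ij by simp
  next
    case 2
    have "represents_level {i, j} (w (a i) + 2 * int e)"
      unfolding represents_level_def
    proof (intro allI impI)
      fix y :: 'k assume y: "y \<noteq> 0" "period dvd w y - (w (a i) + 2 * int e)"
      obtain z where z: "z \<noteq> 0" "w (y * z ^ 2) = w (a i) + 2 * int e"
        "\<And>T v. represents T (v * z ^ 2) \<Longrightarrow> represents T v"
        using represents_shift[OF y] by blast
      have "norm_value c (y * z ^ 2 / a i)" using y z nz by (intro 2) (auto simp: w_divide)
      thus "represents {i, j} y" using rep z(3) nz by fastforce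
    qed
    thus ?thesis by (rule that(1))
  next
    case (3 k)
    have "represents_half {i, j} (w (a i) + int k) (2 * int e - int k)"
      unfolding represents_half_def
    proof (intro allI impI)
      fix x \<rho> :: 'k assume x: "x \<noteq> 0" "\<rho> \<noteq> 0" "period dvd w x - (w (a i) + int k)" "w \<rho> = 2 * int e - int k"
      obtain z where z: "z \<noteq> 0" "w (x * z ^ 2) = w (a i) + int k"
        "\<And>T v. represents T (v * z ^ 2) \<Longrightarrow> represents T v"
        using represents_shift[OF x(1,3)] by blast
      have "norm_value c (x * z ^ 2 / a i) \<or> norm_value c (x * z ^ 2 / a i * (1 + \<rho>))"
        using x z nz by (intro 3) (auto simp: w_divide)
      hence "represents {i, j} (x * z ^ 2) \<or> represents {i, j} (x * (1 + \<rho>) * z ^ 2)"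
        using rep[of "x * z ^ 2 / a i"] rep[of "x * z ^ 2 / a i * (1 + \<rho>)"] nz by (auto simp: mult_ac)
      thus "represents {i, j} x \<or> represents {i, j} (x * (1 + \<rho>))" using z(3) by blast
    qed
    thus ?thesis using that(2) 3 by blast
  qed
qed

lemma represents_half_obtain:
  assumes "represents_half S n r" "r > 0"
  obtains x where "represents S x" "x \<noteq> 0" "w x = n"
proof -
  obtain x where x: "x \<noteq> 0" "w x = n" by (rule w_surj)
  obtain \<rho> where \<rho>: "\<rho> \<noteq> 0" "w \<rho> = r" by (rule w_surj)
  have u: "unit (1 + \<rho>)" using assms \<rho> by (intro unit_add) (auto simp: vge_def)
  have "represents S x \<or> represents S (x * (1 + \<rho>))"
    using assms(1) x \<rho> by (auto simp: represents_half_def)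
  thus ?thesis using that[of x] that[of "x * (1 + \<rho>)"] x u by (auto simp: unit_def w_mult)
qed

text \<open>If \<open>r\<close> exceeded \<open>r'\<close>, then \<open>S\<close> would represent
  \<open>x\<close> and some \<open>x * (1 + \<tau>)\<close> with \<open>w \<tau> = r'\<close>, a
  correction at distance \<open>r\<close> being too deep to alter the leading digit of
  \<open>\<tau>\<close>. The dichotomy for \<open>T\<close> would yield the negative of one of the
  two.\<close>

lemma represents_half_defect:
  assumes ST: "S \<subseteq> I" "T \<subseteq> I" "S \<noteq> {}" "S \<inter> T = {}"
    and S: "represents_half S n r" and T: "represents_half T n' r'"
    and n: "period dvd n - n'" and r: "0 < r'"
  shows "r \<le> r'"
proof (rule ccontr)
  assume "\<not> r \<le> r'"
  hence rr: "r > r'" by simp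
  with r S obtain x where x: "represents S x" "x \<noteq> 0" "w x = n"
    using represents_half_obtain by (metis order_less_trans)
  have cancel: "\<not> represents T (- y)" if "represents S y" for y
    using represents_no_cancel[of S y T] that ST by blast
  obtain \<rho> where \<rho>: "\<rho> \<noteq> 0" "w \<rho> = r" by (rule w_surj)
  obtain \<sigma> where \<sigma>: "\<sigma> \<noteq> 0" "w \<sigma> = r'" by (rule w_surj)
  have u: "unit (1 + \<sigma>)" using r \<sigma> by (intro unit_add) (auto simp: vge_def)
  have "\<exists>\<tau>. \<tau> \<noteq> 0 \<and> w \<tau> = r' \<and> represents S (x * (1 + \<tau>))"
  proof -
    have "represents S (x * (1 + \<sigma>)) \<or> represents S (x * (1 + \<sigma>) * (1 + \<rho>))"
      using S \<rho> x u by (auto simp: represents_half_def unit_def w_mult)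
    moreover have "x * (1 + \<sigma>) * (1 + \<rho>) = x * (1 + (\<sigma> + \<rho> * (1 + \<sigma>)))"
      by (simp add: algebra_simps)
    moreover have "vge (\<rho> * (1 + \<sigma>)) (w \<sigma> + 1)"
      using \<rho> \<sigma> rr u by (auto simp: vge_def w_mult unit_def)
    ultimately show ?thesis using w_add_eq[of \<sigma> "\<rho> * (1 + \<sigma>)"] \<sigma> by metis
  qed
  then obtain \<tau> where \<tau>: "\<tau> \<noteq> 0" "w \<tau> = r'" "represents S (x * (1 + \<tau>))" by blast
  have "represents T (- x) \<or> represents T (- x * (1 + \<tau>))"
    using T[unfolded represents_half_def, rule_format, of "- x" \<tau>] \<tau> x n by simp
  thus False using cancel[OF x(1)] cancel[OF \<tau>(3)] by simp
qed

text \<open>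
  If \<open>x\<close> is represented by \<open>S\<close>, then \<open>- x\<close> is not represented by \<open>T\<close>; for \<open>w y = n + r\<close> the quotient of
  \<open>y - x\<close> by \<open>- x\<close> is \<open>1 - y / x\<close>, so the dichotomy for \<open>T\<close> yields \<open>y - x\<close>.
\<close>

lemma represents_half_union:
  assumes ST: "S \<subseteq> I" "T \<subseteq> I" "S \<noteq> {}" "S \<inter> T = {}"
    and S: "represents_half S n r" and T: "represents_half T n' r"
    and n: "period dvd n - n'" and r: "0 < r"
  shows "represents_level (S \<union> T) (n + r)"
  unfolding represents_level_def
proof (intro allI impI)
  fix y assume y: "y \<noteq> 0" "period dvd w y - (n + r)"
  obtain z where z: "z \<noteq> 0" "w (y * z ^ 2) = n + r"
    "\<And>T v. represents T (v * z ^ 2) \<Longrightarrow> represents T v"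
    using represents_shift[OF y] by blast
  let ?y = "y * z ^ 2"
  obtain x where x: "represents S x" "x \<noteq> 0" "w x = n"
    using S r by (rule represents_half_obtain)
  have "represents T (- x) \<or> represents T (- x * (1 + - (?y / x)))"
    using T x z y n by (intro T[unfolded represents_half_def, rule_format]) (auto simp: w_divide)
  hence "represents T (- x * (1 + - (?y / x)))"
    using represents_no_cancel[of S x T] x(1) ST by blast
  also have "- x * (1 + - (?y / x)) = ?y - x" using x by (simp add: field_simps)
  finally have "represents (S \<union> T) (x + (?y - x))"
    using x ST finite_I by (intro represents_union) (auto intro: finite_subset)
  thus "represents (S \<union> T) y" using z(3) by simp
qed

end

section \<open>Counting variables by level modulo the period\<close>

context anisotropic_form
begin

definition level_class :: "int \<Rightarrow> nat set" where
  "level_class t = {i \<in> I. w (a i) mod period = t}"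

definition landing :: "nat \<Rightarrow> nat \<Rightarrow> nat \<Rightarrow> bool" where
  "landing i j k \<longleftrightarrow> i \<noteq> j \<and> odd k \<and> k < 2 * e \<and> period dvd w (a i) - w (a j) \<and>
     represents_half {i, j} (w (a i) + int k) (2 * int e - int k)"

definition landings :: "nat set \<Rightarrow> int set" where
  "landings R = {(w (a i) + int k) mod period | i j k. i \<in> R \<and> j \<in> R \<and> landing i j k}"

text \<open>The bound 4 allows for a single pair or for two colliding pairs.\<close>

definition saturated :: "int \<Rightarrow> nat set \<Rightarrow> bool" where
  "saturated t R \<longleftrightarrow> (\<exists>S\<subseteq>R. S \<noteq> {} \<and> card S \<le> 4 \<and> represents_level S (t + 2 * int e))"

definition parity_classes :: "int \<Rightarrow> int set" where
  "parity_classes p = {t. 0 \<le> t \<and> t < period \<and> t mod 2 = p}"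

lemma period_pos: "period > 0"
  using m_pos by simp

lemma level_class_finite [simp]: "finite (level_class t)"
  using finite_I by (simp add: level_class_def)

lemma level_class_subset: "level_class t \<subseteq> I"
  by (auto simp: level_class_def)

lemma level_class_dvd: "i \<in> level_class t \<Longrightarrow> period dvd w (a i) - t"
  using mod_eq_dvd_iff[of "w (a i)" period t] by (auto simp: level_class_def)

lemma same_class_dvd: "i \<in> level_class t \<Longrightarrow> j \<in> level_class t \<Longrightarrow> period dvd w (a i) - w (a j)"
  unfolding level_class_def by (simp add: mod_eq_dvd_iff[symmetric])

lemma represents_level_cong:
  assumes "represents_level S n" "period dvd n - n'"
  shows "represents_level S n'"
proof -
  have "period dvd x - n" if "period dvd x - n'" for x
    using dvd_diff[OF that assms(2)] by simp
  thus ?thesis using assms(1) by (auto simp: represents_level_def)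
qed

lemma landings_mono: "R \<subseteq> R' \<Longrightarrow> landings R \<subseteq> landings R'"
  by (auto simp: landings_def)

lemma landings_range: "landings R \<subseteq> {0..<period}"
  using period_pos by (auto simp: landings_def)

lemma landings_finite [simp]: "finite (landings R)"
  using landings_range by (rule finite_subset) simp

text \<open>Comparing defects in both directions forces \<open>k = k'\<close>, hence equal classes;
  \<open>represents_half_union\<close> then applies with \<open>r = 2 * e - k\<close>.\<close>

lemma landing_collision:
  assumes "landing i j k" "landing i' j' k'" "{i, j} \<subseteq> I" "{i', j'} \<subseteq> I" "{i, j} \<inter> {i', j'} = {}"
    and eq: "(w (a i) + int k) mod period = (w (a i') + int k') mod period"
  shows "period dvd w (a i) - w (a i')" "represents_level ({i, j} \<union> {i', j'}) (w (a i) + 2 * int e)"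
proof -
  let ?n = "w (a i) + int k" and ?n' = "w (a i') + int k'"
  have half: "represents_half {i, j} ?n (2 * int e - int k)"
       "represents_half {i', j'} ?n' (2 * int e - int k')"
    and k: "k < 2 * e" "k' < 2 * e"
    using assms by (auto simp: landing_def)
  have d: "period dvd ?n - ?n'" "period dvd ?n' - ?n"
    using eq by (auto simp: mod_eq_dvd_iff[symmetric])
  have "2 * int e - int k \<le> 2 * int e - int k'"
    using k assms(3-5) by (intro represents_half_defect[OF _ _ _ _ half d(1)]) auto
  moreover have "2 * int e - int k' \<le> 2 * int e - int k"
    using k assms(3-5) by (intro represents_half_defect[OF _ _ _ _ half(2,1) d(2)]) auto
  ultimately have kk: "k' = k" by simp
  show "period dvd w (a i) - w (a i')" using d by (simp add: kk)
  have "represents_level ({i, j} \<union> {i', j'}) (?n + (2 * int e - int k))"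
    using k assms(3-5) by (intro represents_half_union[OF _ _ _ _ half(1) half(2)[unfolded kk] d(1)[unfolded kk]]) auto
  thus "represents_level ({i, j} \<union> {i', j'}) (w (a i) + 2 * int e)" by simp
qed

lemma pair_cases:
  assumes "i \<in> level_class t" "j \<in> level_class t" "i \<noteq> j"
  obtains "represents_level {i, j} (t + 2 * int e)" | k where "landing i j k"
proof -
  have "period dvd w (a i) - w (a j)" "i \<in> I" "j \<in> I"
    using assms same_class_dvd[of i t j] level_class_subset[of t] by auto
  from this(2,3) assms(3) this(1) show ?thesis
  proof (cases rule: represents_pair)
    case 1
    moreover have "period dvd w (a i) + 2 * int e - (t + 2 * int e)"
      using level_class_dvd[OF assms(1)] by simp
    ultimately have "represents_level {i, j} (t + 2 * int e)" by (rule represents_level_cong)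
    thus ?thesis by (rule that)
  next
    case (2 k)
    hence "landing i j k" using \<open>period dvd w (a i) - w (a j)\<close> assms(3) by (simp add: landing_def)
    thus ?thesis by (rule that)
  qed
qed

text \<open>Pairs are removed one at a time. Each takes a landing away with it, because a second
  pair arriving there would saturate the set. At most one variable is left over.\<close>

lemma card_unsaturated:
  assumes "R \<subseteq> level_class t" "\<not> saturated t R"
  shows "card R \<le> 2 * card (landings R) + 1"
  using assms
proof (induction "card R" arbitrary: R rule: less_induct)
  case less
  have fin: "finite R" using less.prems(1) by (rule finite_subset) simp
  show ?case
  proof (cases "card R \<le> 1")
    case False
    then obtain i j where ij: "i \<in> R" "j \<in> R" "i \<noteq> j"
      using fin card_le_Suc0_iff_eq[of R] by auto
    have "\<not> represents_level {i, j} (t + 2 * int e)"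
    proof
      assume "represents_level {i, j} (t + 2 * int e)"
      hence "saturated t R" unfolding saturated_def using ij by (intro exI[of _ "{i, j}"]) auto
      thus False using less.prems by simp
    qed
    then obtain k where k: "landing i j k"
      using pair_cases[of i t j] ij less.prems(1) by blast
    define R' where "R' = R - {i, j}"
    let ?l = "(w (a i) + int k) mod period"
    have card: "card R = card R' + 2"
      using ij fin False by (simp add: R'_def card_Diff_subset)
    have sub: "R' \<subseteq> R" by (auto simp: R'_def)
    have "?l \<notin> landings R'"
    proof
      assume "?l \<in> landings R'"
      then obtain i' j' k' where k': "i' \<in> R'" "j' \<in> R'" "landing i' j' k'"
          "?l = (w (a i') + int k') mod period"
        by (auto simp: landings_def)
      have "represents_level ({i, j} \<union> {i', j'}) (w (a i) + 2 * int e)"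
        using k k' ij less.prems(1) level_class_subset sub
        by (intro landing_collision(2)[of i j k i' j' k']) (auto simp: R'_def)
      moreover have "period dvd w (a i) + 2 * int e - (t + 2 * int e)"
        using level_class_dvd[of i t] ij less.prems(1) by auto
      ultimately have "represents_level ({i, j} \<union> {i', j'}) (t + 2 * int e)"
        by (rule represents_level_cong)
      moreover have "card ({i, j} \<union> {i', j'}) \<le> 4"
        using card_Un_le[of "{i, j}" "{i', j'}"] card_insert_le_m1[of 2 "{j}" i] card_insert_le_m1[of 2 "{j'}" i']
        by simp
      ultimately have "saturated t R"
        unfolding saturated_def using ij k' sub by (intro exI[of _ "{i, j} \<union> {i', j'}"]) auto
      thus False using less.prems by simp
    qed
    moreover have "?l \<in> landings R" using ij k by (auto simp: landings_def)
    ultimately have "card (landings R') < card (landings R)"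
      using landings_mono[OF sub] by (intro psubset_card_mono) auto
    moreover have "\<not> saturated t R'"
      using less.prems(2) sub by (auto simp: saturated_def)
    hence "card R' \<le> 2 * card (landings R') + 1"
      using less.prems(1) sub card by (intro less.hyps) auto
    ultimately show ?thesis using card by simp
  qed simp
qed

text \<open>Otherwise \<open>S\<close> would represent \<open>- a i\<close> and cancel the single
  variable \<open>i\<close>.\<close>

lemma level_occupied:
  assumes "S \<subseteq> I" "S \<noteq> {}" "represents_level S n" "i \<in> I" "period dvd w (a i) - n"
  shows "i \<in> S"
proof (rule ccontr)
  assume "i \<notin> S"
  moreover have "represents S (- a i)" using assms coeff_nz by (simp add: represents_level_def)
  ultimately show False
    using represents_no_cancel[of "{i}" "a i" S] represents_singleton assms by auto
qed

lemma levels_disjoint: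
  assumes "S \<subseteq> I" "S' \<subseteq> I" "S \<noteq> {}" "represents_level S n" "represents_level S' n"
  shows "S \<inter> S' \<noteq> {}"
proof
  assume "S \<inter> S' = {}"
  obtain x where "x \<noteq> 0" "w x = n" by (rule w_surj)
  hence "represents S x" "represents S' (- x)" using assms(4,5) by (auto simp: represents_level_def)
  thus False using represents_no_cancel \<open>S \<inter> S' = {}\<close> assms by blast
qed

text \<open>
  Two disjoint sets cannot both represent a whole level, so removing one saturating set of at most
  four variables leaves an unsaturated class.
\<close>

lemma card_level_class_le:
  "card (level_class t) \<le> 2 * card (landings (level_class t)) + (if saturated t (level_class t) then 5 else 1)"
proof (cases "saturated t (level_class t)")
  case True
  then obtain S where S: "S \<subseteq> level_class t" "S \<noteq> {}" "card S \<le> 4" "represents_level S (t + 2 * int e)"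
    by (auto simp: saturated_def)
  have "\<not> saturated t (level_class t - S)"
  proof
    assume "saturated t (level_class t - S)"
    then obtain S' where S': "S' \<subseteq> level_class t - S" "represents_level S' (t + 2 * int e)"
      by (auto simp: saturated_def)
    hence "S \<inter> S' \<noteq> {}"
      using S level_class_subset by (intro levels_disjoint[of S S' "t + 2 * int e"]) auto
    thus False using S' by auto
  qed
  hence "card (level_class t - S) \<le> 2 * card (landings (level_class t - S)) + 1"
    by (intro card_unsaturated) auto
  also have "card (landings (level_class t - S)) \<le> card (landings (level_class t))"
    by (intro card_mono landings_mono) auto
  finally have "card (level_class t - S) \<le> 2 * card (landings (level_class t)) + 1" by simp
  moreover have "card (level_class t) = card (level_class t - S) + card S"
    using S(1) card_Diff_subset[of S] card_mono[of "level_class t" S] finite_subset[OF S(1)] by simp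
  ultimately show ?thesis using S(3) True by simp
next
  case False
  thus ?thesis using card_unsaturated[of "level_class t" t] by simp
qed

lemma card_parity_classes:
  assumes "p \<in> {0, 1}"
  shows "card (parity_classes p) = m"
proof -
  have "parity_classes p = (\<lambda>x. 2 * int x + p) ` {..<m}"
  proof (intro equalityI subsetI)
    fix t assume "t \<in> parity_classes p"
    hence t: "0 \<le> t" "t < period" "t mod 2 = p" by (auto simp: parity_classes_def)
    have "t = 2 * int (nat (t div 2)) + p" "nat (t div 2) < m"
      using t by (simp, use div_mult_mod_eq[of t 2] in linarith, linarith)
    thus "t \<in> (\<lambda>x. 2 * int x + p) ` {..<m}" by blast
  qed (use assms in \<open>auto simp: parity_classes_def\<close>)
  moreover have "inj_on (\<lambda>x. 2 * int x + p) {..<m}" by (auto simp: inj_on_def)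
  ultimately show ?thesis by (simp add: card_image)
qed

lemma finite_parity_classes [simp]: "finite (parity_classes p)"
  by (rule finite_subset[of _ "{0..<period}"]) (auto simp: parity_classes_def)

lemma parity_mod_period: "x mod period mod 2 = x mod 2"
  by (simp add: mod_mod_cancel)

lemma landings_parity:
  assumes "p \<in> {0, 1}" "t \<in> parity_classes p"
  shows "landings (level_class t) \<subseteq> parity_classes (1 - p)"
proof
  fix l assume l: "l \<in> landings (level_class t)"
  then obtain i j k where k: "i \<in> level_class t" "landing i j k" "l = (w (a i) + int k) mod period"
    by (auto simp: landings_def)
  have "w (a i) mod 2 = p"
    using k(1) assms(2) parity_mod_period[of "w (a i)"] by (auto simp: level_class_def parity_classes_def)
  moreover have "odd (int k)" using k(2) by (simp add: landing_def)
  ultimately have "(w (a i) + int k) mod 2 = 1 - p"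
    using assms(1) by (auto; presburger)
  hence "l mod 2 = 1 - p" using k(3) parity_mod_period by simp
  thus "l \<in> parity_classes (1 - p)" using l landings_range[of "level_class t"] by (auto simp: parity_classes_def)
qed

text \<open>Landings from different classes are disjoint, as a collision forces equal classes, and
  they all lie among the \<open>m\<close> classes of opposite parity.\<close>

lemma sum_landings:
  assumes "p \<in> {0, 1}"
  shows "(\<Sum>t\<in>parity_classes p. card (landings (level_class t))) \<le> m"
proof -
  have "landings (level_class t) \<inter> landings (level_class t') = {}" if "t \<noteq> t'" for t t'
  proof (rule ccontr)
    assume "\<not> ?thesis"
    then obtain i j k i' j' k' where
      1: "i \<in> level_class t" "j \<in> level_class t" "landing i j k"
         "i' \<in> level_class t'" "j' \<in> level_class t'" "landing i' j' k'"
         "(w (a i) + int k) mod period = (w (a i') + int k') mod period"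
      by (auto simp: landings_def)
    have "period dvd w (a i) - w (a i')"
      using 1 that by (intro landing_collision(1)[of i j k i' j' k']) (auto simp: level_class_def)
    thus False using that 1 by (simp add: level_class_def mod_eq_dvd_iff[symmetric])
  qed
  hence "(\<Sum>t\<in>parity_classes p. card (landings (level_class t))) = card (\<Union>t\<in>parity_classes p. landings (level_class t))"
    by (subst card_UN_disjoint) auto
  also have "\<dots> \<le> card (parity_classes (1 - p))"
    using landings_parity assms by (intro card_mono) auto
  also have "\<dots> = m" using assms by (intro card_parity_classes) auto
  finally show ?thesis .
qed

text \<open>Now \<open>t + 2 * e\<close> is the class \<open>t\<close> itself, so by
  \<open>level_occupied\<close> a set representing that level swallows the whole class.\<close>

lemma card_level_class_periodic:
  assumes "period dvd 2 * int e"
  shows "card (level_class t) \<le> 2 * card (landings (level_class t)) + 2"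
proof -
  have all: "level_class t \<subseteq> S"
    if S: "S \<subseteq> level_class t" "S \<noteq> {}" "represents_level S (t + 2 * int e)" for S
  proof
    fix i assume i: "i \<in> level_class t"
    have "period dvd w (a i) - t - 2 * int e"
      using level_class_dvd[OF i] assms by (rule dvd_diff)
    thus "i \<in> S" using S i level_class_subset by (intro level_occupied[OF _ S(2,3)]) (auto simp: algebra_simps)
  qed
  show ?thesis
  proof (cases "landings (level_class t) = {}")
    case True
    show ?thesis
    proof (rule ccontr)
      assume "\<not> ?thesis"
      hence c: "card (level_class t) > 2" by simp
      then obtain i j where ij: "i \<in> level_class t" "j \<in> level_class t" "i \<noteq> j"
        using card_le_Suc0_iff_eq[of "level_class t"] by fastforce
      have "represents_level {i, j} (t + 2 * int e)"
        using ij
      proof (cases rule: pair_cases)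
        case (2 k)
        thus ?thesis using True ij by (auto simp: landings_def)
      qed
      hence "card (level_class t) \<le> card {i, j}" using ij by (intro card_mono all) auto
      thus False using c ij(3) by simp
    qed
  next
    case False
    hence n: "card (landings (level_class t)) \<ge> 1" by (simp add: Suc_leI card_gt_0_iff)
    show ?thesis
    proof (cases "saturated t (level_class t)")
      case True
      then obtain S where S: "S \<subseteq> level_class t" "S \<noteq> {}" "card S \<le> 4" "represents_level S (t + 2 * int e)"
        by (auto simp: saturated_def)
      have "card (level_class t) \<le> card S"
        using S all[of S] by (intro card_mono) (auto intro: finite_subset[OF S(1)])
      \<comment> \<open>There is at least one landing, so the right-hand side is at least 4.\<close>
      thus ?thesis using S(3) n by simp
    next
      case False
      thus ?thesis using card_level_class_le[of t] by simp
    qed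
  qed
qed

text \<open>With \<open>s\<close> saturated classes of this parity, each empties its successor and
  saves one leftover variable there, so the total is at most \<open>2 * m + m + 4 * s - s\<close>.
  Since \<open>2 * s \<le> m\<close>, twice the total is at most \<open>9 * m\<close>.\<close>

lemma sum_level_class_aperiodic:
  assumes p: "p \<in> {0, 1}" and np: "\<not> period dvd 2 * int e"
  shows "2 * (\<Sum>t\<in>parity_classes p. card (level_class t)) \<le> 9 * m"
proof -
  define sat where "sat t = (if saturated t (level_class t) then 1 else 0 :: nat)" for t
  define pred where "pred t = (t - 2 * int e) mod period" for t
  have pred_bij: "bij_betw pred (parity_classes p) (parity_classes p)"
  proof -
    have shift: "(t + c) mod period \<in> parity_classes p" if "t \<in> parity_classes p" "even c" for t c
    proof -
      have "(t + c) mod 2 = p" using that by (auto simp: parity_classes_def elim!: evenE)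
      thus ?thesis
        using parity_mod_period[of "t + c"] period_pos by (simp add: parity_classes_def)
    qed
    have "(t + c) mod period = t" if "t \<in> parity_classes p" "c = 0" for t c
      using that by (simp add: parity_classes_def)
    hence inverse: "((t + c) mod period + c') mod period = t" if "t \<in> parity_classes p" "c + c' = 0" for t c c'
      using that by (simp add: mod_add_left_eq add.assoc)
    show ?thesis
    proof (rule bij_betw_byWitness[where f' = "\<lambda>t. (t + 2 * int e) mod period"])
      show "\<forall>t\<in>parity_classes p. (pred t + 2 * int e) mod period = t"
           "\<forall>t\<in>parity_classes p. pred ((t + 2 * int e) mod period) = t"
        using inverse[of _ "- 2 * int e" "2 * int e"] inverse[of _ "2 * int e" "- 2 * int e"]
        by (simp_all add: pred_def)
      show "pred ` parity_classes p \<subseteq> parity_classes p"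
           "(\<lambda>t. (t + 2 * int e) mod period) ` parity_classes p \<subseteq> parity_classes p"
        using shift[of _ "- 2 * int e"] shift[of _ "2 * int e"] by (auto simp: pred_def)
    qed
  qed
  have pred_empty: "level_class t = {}" if t: "t \<in> parity_classes p" and sat: "saturated (pred t) (level_class (pred t))" for t
  proof -
    obtain S where S: "S \<subseteq> level_class (pred t)" "S \<noteq> {}" "represents_level S (pred t + 2 * int e)"
      using sat by (auto simp: saturated_def)
    have "(pred t + 2 * int e) mod period = t mod period"
      by (simp add: pred_def mod_simps)
    hence d: "period dvd t - (pred t + 2 * int e)" by (metis mod_eq_dvd_iff)
    have "pred t \<noteq> t"
    proof
      assume "pred t = t"
      thus False using d np by simp
    qed
    show ?thesis
    proof (rule ccontr)
      assume "level_class t \<noteq> {}"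
      then obtain i where i: "i \<in> level_class t" by auto
      have "period dvd w (a i) - t + (t - (pred t + 2 * int e))"
        using level_class_dvd[OF i] d by (rule dvd_add)
      hence "period dvd w (a i) - (pred t + 2 * int e)" by (simp add: algebra_simps)
      hence "i \<in> S"
        using S(1) i level_class_subset[of t] level_class_subset[of "pred t"]
        by (intro level_occupied[OF _ S(2,3)]) blast+
      thus False using S(1) i \<open>pred t \<noteq> t\<close> by (auto simp: level_class_def)
    qed
  qed
  \<comment> \<open>An empty class is not saturated, because a saturating set is nonempty; summing
    shows that at most half of the classes are saturated.\<close>
  have sat_pred: "sat t + sat (pred t) \<le> 1" if "t \<in> parity_classes p" for t
    using pred_empty[OF that] by (auto simp: sat_def saturated_def)
  have "card (level_class t) + sat (pred t) \<le> 2 * card (landings (level_class t)) + 1 + 4 * sat t"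
    if "t \<in> parity_classes p" for t
    using card_level_class_le[of t] pred_empty[OF that] by (auto simp: sat_def)
  hence "(\<Sum>t\<in>parity_classes p. card (level_class t) + sat (pred t)) \<le>
         (\<Sum>t\<in>parity_classes p. 2 * card (landings (level_class t)) + 1 + 4 * sat t)"
    by (intro sum_mono)
  moreover have "(\<Sum>t\<in>parity_classes p. sat t + sat (pred t)) \<le> (\<Sum>t\<in>parity_classes p. 1)"
    using sat_pred by (intro sum_mono)
  moreover have "(\<Sum>t\<in>parity_classes p. sat (pred t)) = (\<Sum>t\<in>parity_classes p. sat t)"
    using pred_bij by (rule sum.reindex_bij_betw)
  ultimately show ?thesis
    using sum_landings[OF p] card_parity_classes[OF p]
    unfolding sum.distrib sum_distrib_left[symmetric] by simp
qed

lemma card_variables_le: "card I \<le> 9 * m"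
proof -
  have half: "2 * (\<Sum>t\<in>parity_classes p. card (level_class t)) \<le> 9 * m" if p: "p \<in> {0, 1}" for p
  proof (cases "period dvd 2 * int e")
    case True
    have "(\<Sum>t\<in>parity_classes p. card (level_class t)) \<le>
          (\<Sum>t\<in>parity_classes p. 2 * card (landings (level_class t)) + 2)"
      by (intro sum_mono card_level_class_periodic True)
    also have "\<dots> = 2 * (\<Sum>t\<in>parity_classes p. card (landings (level_class t))) + 2 * m"
      unfolding sum.distrib sum_distrib_left[symmetric] using card_parity_classes[OF p] by simp
    finally show ?thesis using sum_landings[OF p] by simp
  next
    case False
    with p show ?thesis by (rule sum_level_class_aperiodic)
  qed
  have "I = (\<Union>t\<in>parity_classes 0 \<union> parity_classes 1. level_class t)"
    using period_pos by (auto simp: level_class_def parity_classes_def)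
  hence "card I \<le> (\<Sum>t\<in>parity_classes 0 \<union> parity_classes 1. card (level_class t))"
    by (metis card_UN_le finite_UnI finite_parity_classes)
  also have "\<dots> = (\<Sum>t\<in>parity_classes 0. card (level_class t)) + (\<Sum>t\<in>parity_classes 1. card (level_class t))"
    by (intro sum.union_disjoint finite_parity_classes) (auto simp: parity_classes_def)
  finally show ?thesis using half[of 0] half[of 1] by simp
qed

end

section \<open>Totally ramified extensions\<close>

lemma two_adic_int_complete:
  fixes b :: "nat \<Rightarrow> two_adic_int"
  obtains l where "\<And>n. 2 ^ n dvd l - (\<Sum>i<n. 2 ^ i * b i)"
proof -
  define p where "p n = (\<Sum>i<n. 2 ^ i * b i)" for n
  \<comment> \<open>The next term does not change the residue modulo \<open>2 ^ n\<close>, so the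
    diagonal residues form a compatible sequence.\<close>
  have "residue_of (2 ^ n * b n) n = 0" for n
    using pow2_dvd_two_adic_int_iff[of n "2 ^ n * b n"] by simp
  hence "residue_of (p (Suc n)) n = residue_of (p n) n" for n
    by (simp add: p_def plus_two_adic_int.rep_eq)
  moreover have "residue_of (p (Suc n)) (Suc n) mod 2 ^ n = residue_of (p (Suc n)) n" for n
    by (rule residue_of_mod) simp
  ultimately have "residue_of (Abs_two_adic_int (\<lambda>n. residue_of (p n) n)) = (\<lambda>n. residue_of (p n) n)"
    by (intro Abs_two_adic_int_inverse) simp
  hence "2 ^ n dvd Abs_two_adic_int (\<lambda>n. residue_of (p n) n) - p n" for n
    by (simp add: pow2_dvd_two_adic_int_iff minus_two_adic_int.rep_eq)
  thus ?thesis unfolding p_def by (rule that)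
qed

lemma two_adic_val_Fract:
  assumes "2 ^ n dvd x" "x \<noteq> 0"
  shows "int n \<le> two_adic_val (Fract x 1)"
proof -
  obtain y where y: "x = 2 ^ n * y" using assms(1) by (rule dvdE)
  then obtain k u where u: "u dvd 1" "y = 2 ^ k * u"
    using assms(2) by (auto intro: two_adic_int_decompose[of y])
  have "Fract x 1 = Fract (2 ^ (n + k)) 1 * Fract u 1"
    by (simp add: y u power_add mult.assoc)
  also have "\<dots> = 2 powi int (n + k) * Fract u 1"
    by (simp only: power_int_of_nat pow2_Fract)
  finally have "two_adic_val (Fract x 1) = int (n + k)" by (rule two_adic_val_eq[OF u(1)])
  thus ?thesis by simp
qed

lemma two_adic_eq_Fract:
  assumes "c = 0 \<or> int n \<le> two_adic_val c"
  obtains b where "c = Fract (2 ^ n * b) 1"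
proof (cases "c = 0")
  case True
  thus ?thesis using that[of 0] by (simp add: Zero_fract_def)
next
  case False
  then obtain k u where u: "u dvd 1" "c = 2 powi k * Fract u 1" by (rule two_adic_decompose)
  with assms False have "int n \<le> k" using two_adic_val_eq by auto
  then obtain j where "k = int (n + j)" by (metis zle_iff_zadd of_nat_add)
  hence "c = Fract (2 ^ (n + j)) 1 * Fract u 1"
    using u(2) by (simp only: power_int_of_nat pow2_Fract)
  thus ?thesis using that[of "2 ^ j * u"] by (simp add: power_add mult.assoc)
qed

section \<open>Coordinates in powers of a uniformizer\<close>

locale ramified_extension = valued_field w for w :: "'k::field \<Rightarrow> int" +
  fixes \<iota> :: "two_adic \<Rightarrow> 'k" and e :: nat
  assumes finite_extension: "finite_extension \<iota>" and degree: "extension_degree \<iota> = e"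
    and w_embedding: "\<And>x. x \<noteq> 0 \<Longrightarrow> w (\<iota> x) = int e * two_adic_val x"
begin

lemma hom_one [simp]: "\<iota> 1 = 1" and hom_add: "\<iota> (x + y) = \<iota> x + \<iota> y" and hom_mult: "\<iota> (x * y) = \<iota> x * \<iota> y"
  using finite_extension by (auto simp: finite_extension_def field_embedding_def)

lemma hom_zero [simp]: "\<iota> 0 = 0"
  by (metis add.right_neutral add_left_cancel hom_add)

lemma hom_minus: "\<iota> (- x) = - \<iota> x"
  using hom_add[of x "- x"] by (simp add: eq_neg_iff_add_eq_0 add.commute)

lemma hom_diff: "\<iota> (x - y) = \<iota> x - \<iota> y"
  using hom_add[of x "- y"] by (simp add: hom_minus)

lemma hom_eq_0 [simp]: "\<iota> x = 0 \<longleftrightarrow> x = 0"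
proof
  assume "\<iota> x = 0"
  show "x = 0"
  proof (rule ccontr)
    assume "x \<noteq> 0"
    hence "\<iota> x * \<iota> (inverse x) = 1" by (simp add: hom_mult[symmetric])
    thus False using \<open>\<iota> x = 0\<close> by simp
  qed
qed simp

sublocale vs: vector_space "\<lambda>c x. \<iota> c * x"
  by unfold_locales (auto simp: hom_add hom_mult algebra_simps)

lemma basis:
  obtains B where "finite B" "vs.independent B" "vs.span B = UNIV" "card B = e"
proof -
  obtain G where G: "finite G" "vs.span G = UNIV"
    using finite_extension by (auto simp: finite_extension_def)
  obtain B where B: "vs.independent B" "UNIV \<subseteq> vs.span B" "card B = vs.dim UNIV"
    by (rule vs.basis_exists[of UNIV])
  have "finite B" using vs.independent_span_bound[of G B] G B(1) by simp
  thus ?thesis using that B degree by (auto simp: extension_degree_def)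
qed

lemma e_pos: "e > 0"
proof (rule ccontr)
  assume "\<not> e > 0"
  then obtain B where "B = {}" "vs.span B = UNIV" using basis by (metis card_0_eq gr0I)
  hence "(1 :: 'k) \<in> {0}" by (metis UNIV_I vs.span_empty)
  thus False by simp
qed

definition \<pi> :: 'k where
  "\<pi> = (SOME x. x \<noteq> 0 \<and> w x = 1)"

lemma uniformizer: "\<pi> \<noteq> 0" "w \<pi> = 1"
proof -
  have "\<exists>x. x \<noteq> 0 \<and> w x = 1" using w_surj by metis
  thus "\<pi> \<noteq> 0" "w \<pi> = 1" unfolding \<pi>_def by (metis (mono_tags, lifting) someI_ex)+
qed

lemma w_term: "c \<noteq> 0 \<Longrightarrow> w (\<iota> c * \<pi> ^ i) = int e * two_adic_val c + int i"
  using uniformizer by (simp add: w_mult w_power w_embedding)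

text \<open>The values of the terms are congruent to their indices modulo \<open>e\<close>, hence
  distinct.\<close>

lemma w_expansion:
  assumes "A \<subseteq> {..<e}" "A \<noteq> {}" "\<And>i. i \<in> A \<Longrightarrow> c i \<noteq> 0"
  shows "(\<Sum>i\<in>A. \<iota> (c i) * \<pi> ^ i) \<noteq> 0 \<and>
    w (\<Sum>i\<in>A. \<iota> (c i) * \<pi> ^ i) = Min ((\<lambda>i. w (\<iota> (c i) * \<pi> ^ i)) ` A)"
proof (rule w_sum_inj)
  show "finite A" using assms(1) by (rule finite_subset) simp
  show "inj_on (\<lambda>i. w (\<iota> (c i) * \<pi> ^ i)) A"
  proof (rule inj_onI)
    fix i j assume ij: "i \<in> A" "j \<in> A" "w (\<iota> (c i) * \<pi> ^ i) = w (\<iota> (c j) * \<pi> ^ j)"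
    hence "(int e * two_adic_val (c i) + int i) mod int e = (int e * two_adic_val (c j) + int j) mod int e"
      using assms(3) by (simp add: w_term)
    moreover have "i < e" "j < e" using ij assms(1) by auto
    ultimately show "i = j" by simp
  qed
qed (use assms uniformizer in auto)

text \<open>The \<open>e\<close> powers are independent by \<open>w_expansion\<close>, and
  \<open>e\<close> is also the degree, so they form a basis. Total ramification enters here.\<close>

lemma expansion:
  obtains c where "x = (\<Sum>i<e. \<iota> (c i) * \<pi> ^ i)"
proof -
  have inj: "inj_on (\<lambda>i. \<pi> ^ i) {..<e}"
  proof (rule inj_onI)
    fix i j assume "\<pi> ^ i = \<pi> ^ j"
    moreover have "w (\<pi> ^ i) = int i" "w (\<pi> ^ j) = int j" by (simp_all add: w_power uniformizer)
    ultimately show "i = j" by (metis of_nat_eq_iff)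
  qed
  define P where "P = (\<lambda>i. \<pi> ^ i) ` {..<e}"
  have "vs.independent P"
  proof (rule vs.independent_if_scalars_zero)
    fix f v assume f: "(\<Sum>v\<in>P. \<iota> (f v) * v) = 0" and v: "v \<in> P"
    show "f v = 0"
    proof (rule ccontr)
      assume fv: "f v \<noteq> 0"
      define A where "A = {i \<in> {..<e}. f (\<pi> ^ i) \<noteq> 0}"
      have "A \<subseteq> {..<e}" "A \<noteq> {}" "\<And>i. i \<in> A \<Longrightarrow> f (\<pi> ^ i) \<noteq> 0"
        using fv v unfolding A_def P_def by blast+
      hence "(\<Sum>i\<in>A. \<iota> (f (\<pi> ^ i)) * \<pi> ^ i) \<noteq> 0"
        using w_expansion[of A "\<lambda>i. f (\<pi> ^ i)"] by blast
      moreover have "(\<Sum>i\<in>A. \<iota> (f (\<pi> ^ i)) * \<pi> ^ i) = (\<Sum>i<e. \<iota> (f (\<pi> ^ i)) * \<pi> ^ i)"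
        by (intro sum.mono_neutral_left) (auto simp: A_def)
      moreover have "\<dots> = (\<Sum>v\<in>P. \<iota> (f v) * v)"
        unfolding P_def using inj by (subst sum.reindex) auto
      ultimately show False using f by simp
    qed
  qed (simp add: P_def)
  moreover have "card P = e" unfolding P_def using inj by (simp add: card_image)
  moreover obtain B where B: "finite B" "vs.independent B" "vs.span B = UNIV" "card B = e" by (rule basis)
  moreover have fin_dim: "finite_dimensional_vector_space (\<lambda>c x. \<iota> c * x) B"
    using B by unfold_locales auto
  ultimately have "UNIV \<subseteq> vs.span P"
    using degree
    by (intro finite_dimensional_vector_space.card_ge_dim_independent[OF fin_dim])
       (auto simp: extension_degree_def)
  moreover have "finite P" by (simp add: P_def)
  ultimately obtain f where "x = (\<Sum>v\<in>P. \<iota> (f v) * v)"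
    using vs.span_finite[of P] by auto
  also have "\<dots> = (\<Sum>i<e. \<iota> (f (\<pi> ^ i)) * \<pi> ^ i)"
    unfolding P_def using inj by (subst sum.reindex) auto
  finally show ?thesis by (rule that)
qed

definition hom_int :: "two_adic_int \<Rightarrow> 'k" where
  "hom_int b = \<iota> (Fract b 1)"

lemma hom_int_diff: "hom_int (x - y) = hom_int x - hom_int y"
  by (simp add: hom_int_def hom_diff[symmetric])

lemma hom_int_add: "hom_int (x + y) = hom_int x + hom_int y"
  by (simp add: hom_int_def hom_add[symmetric])

lemma hom_int_1 [simp]: "hom_int 1 = 1"
  by (simp add: hom_int_def One_fract_def[symmetric])

lemma hom_int_0 [simp]: "hom_int 0 = 0"
  by (simp add: hom_int_def Zero_fract_def[symmetric])

lemma vge_hom_int: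
  assumes "2 ^ n dvd b"
  shows "vge (hom_int b) (int e * int n)"
proof (cases "b = 0")
  case False
  hence "Fract b 1 \<noteq> 0" by (simp add: Zero_fract_def eq_fract)
  thus ?thesis
    using mult_left_mono[OF two_adic_val_Fract[OF assms False], of "int e"]
    by (simp add: vge_def hom_int_def w_embedding)
qed simp

text \<open>No nonzero term has smaller value than \<open>x\<close>; as \<open>i < e\<close>, the
  offset \<open>int i\<close> cannot make up for a missing factor 2.\<close>

lemma integral_expansion:
  assumes "vge x (int e * int n)"
  obtains b where "x = (\<Sum>i<e. hom_int (2 ^ n * b i) * \<pi> ^ i)"
proof -
  obtain c where c: "x = (\<Sum>i<e. \<iota> (c i) * \<pi> ^ i)" by (rule expansion)
  define A where "A = {i \<in> {..<e}. c i \<noteq> 0}"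
  have xA: "x = (\<Sum>i\<in>A. \<iota> (c i) * \<pi> ^ i)"
    unfolding c by (intro sum.mono_neutral_right) (auto simp: A_def)
  have "\<exists>b. c i = Fract (2 ^ n * b) 1" if "i < e" for i
  proof (cases "c i = 0")
    case False
    hence iA: "i \<in> A" using that by (simp add: A_def)
    have "x \<noteq> 0 \<and> w x = Min ((\<lambda>i. w (\<iota> (c i) * \<pi> ^ i)) ` A)"
      unfolding xA using iA by (intro w_expansion) (auto simp: A_def)
    moreover have "Min ((\<lambda>i. w (\<iota> (c i) * \<pi> ^ i)) ` A) \<le> w (\<iota> (c i) * \<pi> ^ i)"
      using iA by (intro Min_le) (auto simp: A_def)
    ultimately have "int e * int n \<le> int e * two_adic_val (c i) + int i"
      using assms False by (simp add: vge_def w_term)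
    also have "\<dots> < int e * (two_adic_val (c i) + 1)" using that by (simp add: distrib_left)
    finally have "int n \<le> two_adic_val (c i)" using e_pos by simp
    thus ?thesis by (metis two_adic_eq_Fract)
  qed (metis two_adic_eq_Fract)
  then obtain b where "\<And>i. i < e \<Longrightarrow> c i = Fract (2 ^ n * b i) 1" by metis
  hence "x = (\<Sum>i<e. hom_int (2 ^ n * b i) * \<pi> ^ i)"
    unfolding c hom_int_def by (intro sum.cong) auto
  thus ?thesis by (rule that)
qed

lemma vge_pi_power: "vge (\<pi> ^ i) (int i)"
  using uniformizer by (simp add: vge_def w_power)

text \<open>Modulo the maximal ideal \<open>x\<close> equals its constant coordinate, a 2-adic
  integer that must be odd and so is congruent to 1.\<close>

lemma residue_field:
  assumes "x \<noteq> 0" "w x = 0"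
  shows "vge (x - 1) 1"
proof -
  obtain b where "x = (\<Sum>i<e. hom_int (2 ^ 0 * b i) * \<pi> ^ i)"
    using assms integral_expansion[of x 0] by (auto simp: vge_def)
  moreover obtain e' where e': "e = Suc e'" using e_pos gr0_implies_Suc by blast
  ultimately have x: "x - hom_int (b 0) = (\<Sum>i<e'. hom_int (b (Suc i)) * \<pi> ^ Suc i)"
    by (simp add: sum.lessThan_Suc_shift del: sum.lessThan_Suc)
  have near: "vge (x - hom_int (b 0)) 1"
    unfolding x
  proof (rule vge_sum)
    fix i
    have "vge (hom_int (b (Suc i)) * \<pi> ^ Suc i) (int e * int 0 + int (Suc i))"
      by (intro vge_mult vge_hom_int vge_pi_power) simp
    thus "vge (hom_int (b (Suc i)) * \<pi> ^ Suc i) 1" by (rule vge_mono) simp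
  qed
  have "\<not> 2 dvd b 0"
  proof
    assume "2 dvd b 0"
    hence "vge (hom_int (b 0)) 1" using vge_hom_int[of 1 "b 0"] e_pos by (auto intro: vge_mono)
    hence "vge (x - hom_int (b 0) + hom_int (b 0)) 1" using near by (intro vge_add)
    thus False using assms by (simp add: vge_def)
  qed
  hence "residue_of (b 0) 1 \<noteq> 0" using pow2_dvd_two_adic_int_iff[of 1 "b 0"] by simp
  hence "residue_of (b 0) 1 = 1" using residue_of_range[of "b 0" 1] by simp
  hence "2 dvd b 0 - 1"
    using pow2_dvd_two_adic_int_iff[of 1 "b 0 - 1"] by (simp add: minus_two_adic_int.rep_eq one_two_adic_int.rep_eq)
  hence "vge (hom_int (b 0) - 1) 1"
    using vge_hom_int[of 1 "b 0 - 1"] e_pos by (auto simp: hom_int_diff intro: vge_mono)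
  hence "vge (x - hom_int (b 0) + (hom_int (b 0) - 1)) 1" using near by (intro vge_add)
  thus ?thesis by simp
qed

text \<open>The coordinates of the \<open>n\<close>-th step are divisible by \<open>2 ^ n\<close>,
  so each coordinate converges in the 2-adic integers.\<close>

lemma sparse_limit:
  assumes "\<And>n. vge (x (Suc n) - x n) (int e * int n)"
  obtains l where "\<And>n. vge (l - x n) (int e * int n)"
proof -
  have "\<exists>b. x (Suc n) - x n = (\<Sum>i<e. hom_int (2 ^ n * b i) * \<pi> ^ i)" for n
    using integral_expansion[OF assms[of n]] by metis
  then obtain b where b: "\<And>n. x (Suc n) - x n = (\<Sum>i<e. hom_int (2 ^ n * b n i) * \<pi> ^ i)" by metis
  define p where "p i n = (\<Sum>k<n. 2 ^ k * b k i)" for i n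
  have "\<exists>l. \<forall>n. 2 ^ n dvd l - p i n" for i
    unfolding p_def by (metis two_adic_int_complete)
  then obtain L where L: "\<And>i n. 2 ^ n dvd L i - p i n" by metis
  have x: "x n = x 0 + (\<Sum>i<e. hom_int (p i n) * \<pi> ^ i)" for n
  proof (induction n)
    case (Suc n)
    have "x (Suc n) = x n + (\<Sum>i<e. hom_int (2 ^ n * b n i) * \<pi> ^ i)"
      by (simp add: b[symmetric])
    thus ?case unfolding Suc.IH
      by (simp add: p_def hom_int_add sum.distrib distrib_right add.assoc)
  qed (simp add: p_def)
  show ?thesis
  proof (rule that)
    fix n
    have "x 0 + (\<Sum>i<e. hom_int (L i) * \<pi> ^ i) - x n = (\<Sum>i<e. hom_int (L i - p i n) * \<pi> ^ i)"
      by (subst x[of n]) (simp add: hom_int_diff left_diff_distrib sum_subtractf)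
    also have "vge \<dots> (int e * int n)"
    proof (rule vge_sum)
      fix i
      have "vge (hom_int (L i - p i n) * \<pi> ^ i) (int e * int n + int i)"
        by (intro vge_mult vge_hom_int vge_pi_power L)
      thus "vge (hom_int (L i - p i n) * \<pi> ^ i) (int e * int n)" by (rule vge_mono) simp
    qed
    finally show "vge (x 0 + (\<Sum>i<e. hom_int (L i) * \<pi> ^ i) - x n) (int e * int n)" .
  qed
qed

lemma limit:
  assumes "\<And>n. vge (x (Suc n) - x n) (int n)"
  shows "\<exists>l. \<forall>n. vge (l - x n) (int n)"
proof -
  have steps: "vge (x (n + k) - x n) (int n)" for n k
  proof (induction k)
    case (Suc k)
    have "vge (x (Suc (n + k)) - x (n + k)) (int n)" using assms[of "n + k"] by (rule vge_mono) simp
    hence "vge (x (n + k) - x n + (x (Suc (n + k)) - x (n + k))) (int n)" using Suc by (intro vge_add)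
    thus ?case by simp
  qed simp
  \<comment> \<open>Keeping only every \<open>e\<close>-th term gives the step size that
    \<open>sparse_limit\<close> requires.\<close>
  have "vge (x (e * Suc n) - x (e * n)) (int e * int n)" for n
    using steps[of "e * n" e] by (simp add: add.commute)
  then obtain l where l: "\<And>n. vge (l - x (e * n)) (int e * int n)"
    using sparse_limit[of "\<lambda>n. x (e * n)"] by blast
  have "vge (l - x n) (int n)" for n
  proof -
    have ne: "n \<le> e * n" using e_pos by simp
    have "int n \<le> int e * int n" using ne by (metis of_nat_le_iff of_nat_mult)
    with l[of n] have "vge (l - x (e * n)) (int n)" by (rule vge_mono)
    hence "vge (l - x (e * n) + (x (e * n) - x n)) (int n)"
      using steps[of n "e * n - n"] ne by (intro vge_add) auto
    thus ?thesis by simp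
  qed
  thus ?thesis by blast
qed

sublocale dyadic_field w e
proof
  have two: "\<iota> 2 = 2" using hom_add[of 1 1] by simp
  show "(2 :: 'k) \<noteq> 0" using two two_adic_two_neq_0 hom_eq_0 by metis
  have "two_adic_val 2 = 1"
    by (rule two_adic_val_eq[of 1]) (auto simp: One_fract_def[symmetric])
  thus "w 2 = int e" using w_embedding[of 2] two by simp
qed (use e_pos residue_field limit in auto)

end

section \<open>Transfer to additive forms of degree \<open>2 * m\<close>\<close>

lemma (in dyadic_field) power_of_divisible:
  assumes "odd m" "y \<noteq> 0" "int m dvd w y"
  obtains x where "x \<noteq> 0" "x ^ m = y"
proof -
  obtain q where q: "w y = int m * q" using assms(3) by (rule dvdE)
  obtain z where z: "z \<noteq> 0" "w z = q" by (rule w_surj)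
  \<comment> \<open>\<open>z ^ m\<close> takes up the whole valuation of \<open>y\<close>; the
    remaining unit has an \<open>m\<close>-th root.\<close>
  have "unit (y / z ^ m)" using assms z q by (simp add: unit_def w_divide w_power)
  with assms(1) obtain v where v: "unit v" "v ^ m = y / z ^ m" by (rule unit_root)
  hence "(z * v) ^ m = y" using z by (simp add: power_mult_distrib)
  thus ?thesis using that[of "z * v"] z v by (simp add: unit_def)
qed

lemma nontrivial_zero_if_zero_coeff:
  assumes "d > 0" "i < s" "a i = 0"
  shows "has_nontrivial_zero d s a"
proof -
  have "additive_form d s a (\<lambda>j. if j = i then 1 else 0) = 0"
    unfolding additive_form_def using assms by (intro sum.neutral) auto
  thus ?thesis unfolding has_nontrivial_zero_def using assms(2) by (intro exI[of _ "\<lambda>j. if j = i then 1 else 0"]) auto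
qed

text \<open>An admissible \<open>y i\<close> is a power \<open>x i ^ m\<close>, so a vanishing sum
  of the \<open>a i * y i ^ 2\<close> is a zero of the form, and the count of variables applies to a
  form without zeros.\<close>

lemma (in ramified_extension) has_nontrivial_zero_twice_odd:
  fixes a :: "nat \<Rightarrow> 'k"
  assumes "odd m" and s: "s > 9 * m"
  shows "has_nontrivial_zero (2 * m) s a"
proof (rule ccontr)
  assume no_zero: "\<not> has_nontrivial_zero (2 * m) s a"
  have m: "m > 0" using assms(1) by (rule odd_pos)
  interpret anisotropic_form w e m a "{..<s}"
  proof
    show "a i \<noteq> 0" if "i \<in> {..<s}" for i
      using no_zero nontrivial_zero_if_zero_coeff[of "2 * m" i s a] that m by auto
  next
    fix S and y :: "nat \<Rightarrow> 'k"
    assume S: "S \<subseteq> {..<s}" "S \<noteq> {}" and y: "\<And>i. i \<in> S \<Longrightarrow> y i \<noteq> 0 \<and> int m dvd w (y i)"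
    have "\<exists>x. x \<noteq> 0 \<and> x ^ m = y i" if "i \<in> S" for i
      using power_of_divisible[OF assms(1)] y[OF that] by metis
    then obtain x where x: "\<And>i. i \<in> S \<Longrightarrow> x i \<noteq> 0 \<and> x i ^ m = y i" by metis
    let ?x = "\<lambda>i. if i \<in> S then x i else 0"
    have "x i ^ (2 * m) = y i ^ 2" if "i \<in> S" for i
      using x[OF that] power_mult[of "x i" m 2] by (simp add: mult.commute)
    hence form: "additive_form (2 * m) s a ?x = (\<Sum>i\<in>S. a i * y i ^ 2)"
      unfolding additive_form_def using S(1) m
      by (intro sum.mono_neutral_cong_right) auto
    obtain i where i: "i \<in> S" "i < s" using S by blast
    show "(\<Sum>i\<in>S. a i * y i ^ 2) \<noteq> 0"
    proof
      assume "(\<Sum>i\<in>S. a i * y i ^ 2) = 0"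
      hence "additive_form (2 * m) s a ?x = 0" using form by (rule trans[rotated])
      moreover have "?x i \<noteq> 0" using i x by simp
      ultimately have "has_nontrivial_zero (2 * m) s a"
        unfolding has_nontrivial_zero_def using i(2) by (intro exI[of _ ?x] conjI exI[of _ i])
      thus False using no_zero by contradiction
    qed
  qed (use m in auto)
  show False using card_variables_le s by simp
qed

theorem theorem1:
  fixes d m :: nat and \<iota> :: "two_adic \<Rightarrow> 'k::field"
  assumes "d = 2 * m" and "odd m" and "m \<ge> 3"
    and "totally_ramified_extension \<iota>"
  shows "(\<forall>s. s \<ge> d\<^sup>2 div 4 + 3 * d + 1 \<longrightarrow> (\<forall>a :: nat \<Rightarrow> 'k. has_nontrivial_zero d s a)) \<and>
         Gamma_star d TYPE('k) \<le> enat (d\<^sup>2 div 4 + 3 * d + 1)"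
proof -
  obtain w :: "'k \<Rightarrow> int" where w: "normalized_valuation w"
      "\<And>x. x \<noteq> 0 \<Longrightarrow> w (\<iota> x) = int (extension_degree \<iota>) * two_adic_val x"
    using assms(4) unfolding totally_ramified_extension_def has_ramification_index_def by blast
  interpret ramified_extension w \<iota> "extension_degree \<iota>"
    using assms(4) w by unfold_locales (auto simp: totally_ramified_extension_def)
  \<comment> \<open>With \<open>d = 2 * m\<close> the bound reads \<open>m * m + 6 * m + 1\<close>,
    which must exceed \<open>9 * m\<close>.\<close>
  have "3 * m \<le> m * m" using assms(3) by (rule mult_right_mono) simp
  moreover have "d\<^sup>2 div 4 = m * m" using assms(1) by (simp add: power2_eq_square)
  ultimately have bound: "9 * m < d\<^sup>2 div 4 + 3 * d + 1" using assms(1) by linarith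
  have zeros: "\<forall>s. s \<ge> d\<^sup>2 div 4 + 3 * d + 1 \<longrightarrow> (\<forall>a :: nat \<Rightarrow> 'k. has_nontrivial_zero d s a)"
    using has_nontrivial_zero_twice_odd[OF assms(2)] bound assms(1) by (meson order_less_le_trans)
  hence "Gamma_star d TYPE('k) \<le> enat (d\<^sup>2 div 4 + 3 * d + 1)"
    unfolding Gamma_star_def by (intro Inf_lower) blast
  with zeros show ?thesis ..
qed

end
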